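(* Let $A$ be a (necessarily unital) $C^*$-algebra and let $u, v \in A$ be extremal partial isometries such that $\|u - v\| < 2$. Then $u$ and $v$ are homotopic through extremal partial isometries in $A$; that is, there is a norm-continuous map $w : [0,1] \to A$ such that $w(t)$ is an extremal partial isometry of $A$ for every $t \in [0,1]$, $w(0) = u$ and $w(1) = v$.
   Context: An extremal partial isometry of a $C^*$-algebra $A$ is an extreme point of the closed unit ball of $A$. Known facts: the unit ball of $A$ has extreme points if and only if $A$ is unital (Sakai); extreme points are necessarily partial isometries; and, for a partial isometry $u$ in $A$ with $\mathbf{1}$ the identity of $A$, $u$ is an extreme point if and only if $(\mathbf{1} - uu^* )A(\mathbf{1} - u^*u) = \{0\}$ (Kadison). *)

theory Defs
  imports "HOL-Analysis.Analysis"
begin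

text \<open>
  Complex C*-algebras. No unit is assumed, and the zero algebra is allowed (the library's
  unital class \<open>real_normed_algebra_1\<close> would exclude it). Completeness and
  submultiplicativity of the norm come from \<open>banach\<close> and \<open>real_normed_algebra\<close>; the axiom
  \<open>scaleR_scaleC\<close> says that the underlying real structure is the restriction of the complex one.
\<close>

class c_star_algebra = real_normed_algebra + banach +
  fixes scaleC :: "complex \<Rightarrow> 'a \<Rightarrow> 'a"  (infixr "*\<^sub>C" 75)
    and star :: "'a \<Rightarrow> 'a"
  assumes scaleC_add_right: "a *\<^sub>C (x + y) = a *\<^sub>C x + a *\<^sub>C y"
    and scaleC_add_left: "(a + b) *\<^sub>C x = a *\<^sub>C x + b *\<^sub>C x"
    and scaleC_scaleC: "a *\<^sub>C (b *\<^sub>C x) = (a * b) *\<^sub>C x"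
    and scaleR_scaleC: "r *\<^sub>R x = complex_of_real r *\<^sub>C x"
    and mult_scaleC_left: "(a *\<^sub>C x) * y = a *\<^sub>C (x * y)"
    and mult_scaleC_right: "x * (a *\<^sub>C y) = a *\<^sub>C (x * y)"
    and norm_scaleC: "norm (a *\<^sub>C x) = cmod a * norm x"
    and star_star: "star (star x) = x"
    and star_add: "star (x + y) = star x + star y"
    and star_scaleC: "star (a *\<^sub>C x) = cnj a *\<^sub>C star x"
    and star_mult: "star (x * y) = star y * star x"
    and c_star_identity: "norm (star x * x) = (norm x)\<^sup>2"

definition extremal_partial_isometry :: "'a::c_star_algebra \<Rightarrow> bool" where
  "extremal_partial_isometry u \<longleftrightarrow> u extreme_point_of (cball 0 1)"

end

theory Submission
  imports Defs
begin

text \<open>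
  Let \<open>x t = (1 - t) u + t v\<close>. For \<open>t \<le> 1/2\<close> this element has distance less than \<open>1\<close> from
  \<open>u\<close>, and for \<open>t \<ge> 1/2\<close> distance less than \<open>1\<close> from \<open>v\<close>. An element \<open>x\<close> within distance
  \<open>1\<close> of an extremal partial isometry has a generalised inverse, hence a kernel projection \<open>e\<close>
  and a polar part \<open>w = x (x\<^sup>* x + e)\<^bsup>-1/2\<^esup>\<close>; these are determined by \<open>x\<close> alone and depend
  continuously on it, and \<open>w\<close> inherits Kadison's condition. So the polar part of \<open>x t\<close> is the
  required path.

  No spectral theory is used. Square roots come from the fixed point equation
  \<open>s = (x + s\<^sup>2) / 2\<close> for \<open>s = 1 - sqrt (1 - x)\<close>, and norm bounds from the fact that
  \<open>f + \<i> g\<close> is unitary if \<open>f\<close> and \<open>g\<close> are self-adjoint and commute and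
  \<open>f\<^sup>2 + g\<^sup>2 = 1\<close>. Positivity of \<open>x\<^sup>* x\<close> is avoided: \<open>|T|\<close> replaces
  \<open>T = x\<^sup>* x + e\<close>, which makes \<open>k = w\<^sup>* w\<close> satisfy \<open>k\<^sup>3 = k\<close>, and this already
  forces \<open>k\<^sup>2 = k\<close>.
\<close>

section \<open>Norm and involution\<close>

lemma norm_star [simp]: "norm (star x) = norm (x::'a::c_star_algebra)"
proof -
  have le: "norm y \<le> norm (star y)" for y :: 'a
  proof (cases "y = 0")
    case False
    have "norm y * norm y \<le> norm (star y) * norm y"
      using norm_mult_ineq[of "star y" y] by (simp add: c_star_identity power2_eq_square)
    with False show ?thesis by simp
  qed simp
  show ?thesis using le[of x] le[of "star x"] by (simp add: star_star)
qed

lemma star_scaleR: "star (r *\<^sub>R x) = r *\<^sub>R star (x::'a::c_star_algebra)"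
  by (simp add: scaleR_scaleC star_scaleC)

lemma bounded_linear_star: "bounded_linear (star :: 'a::c_star_algebra \<Rightarrow> 'a)"
  by (rule bounded_linear_intro[of _ 1]) (simp_all add: star_add star_scaleR)

lemma star_zero [simp]: "star (0::'a::c_star_algebra) = 0"
  and star_minus: "star (- x) = - star (x::'a::c_star_algebra)"
  and star_diff: "star (x - y) = star x - star (y::'a::c_star_algebra)"
  by (simp_all add: linear_0 linear_neg linear_diff bounded_linear.linear[OF bounded_linear_star])

lemmas star_simps = star_add star_diff star_minus star_mult star_scaleR star_star

lemma continuous_on_star [continuous_intros]:
  "continuous_on S f \<Longrightarrow> continuous_on S (\<lambda>s. star (f s :: 'a::c_star_algebra))"
  by (rule bounded_linear.continuous_on[OF bounded_linear_star])

lemma star_mult_self_eq_0: "star x * x = 0 \<longleftrightarrow> x = (0::'a::c_star_algebra)"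
  using c_star_identity[of x] by auto

lemma scaleC_ii_ii: "\<i> *\<^sub>C (\<i> *\<^sub>C x) = - (x::'a::c_star_algebra)"
  using scaleR_scaleC[of "-1" x] by (simp add: scaleC_scaleC)

lemma scaleC_scaleR: "c *\<^sub>C (r *\<^sub>R x) = r *\<^sub>R (c *\<^sub>C (x::'a::c_star_algebra))"
  by (simp add: scaleR_scaleC scaleC_scaleC mult.commute)

lemma scaleC_minus_right: "c *\<^sub>C (- x) = - (c *\<^sub>C (x::'a::c_star_algebra))"
proof -
  have "c *\<^sub>C (0::'a) = 0" using scaleC_add_right[of c 0 0] by simp
  then show ?thesis by (simp add: eq_neg_iff_add_eq_0 flip: scaleC_add_right)
qed

lemma scaleC_minus_left: "(- c) *\<^sub>C x = - (c *\<^sub>C (x::'a::c_star_algebra))"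
  using scaleC_add_left[of "-c" c x] scaleC_add_left[of 0 0 x]
  by (simp add: eq_neg_iff_add_eq_0)

lemma star_scaleC_ii: "star (\<i> *\<^sub>C x) = - (\<i> *\<^sub>C star (x::'a::c_star_algebra))"
  by (simp add: star_scaleC scaleC_minus_left)

text \<open>This stands in for monotonicity of the norm on positive elements. The hypothesis cancels
  the cross terms, so \<open>star z * z\<close> equals \<open>star v * v + star t * t\<close> for
  both \<open>z = v + it\<close> and \<open>z = v - it\<close>, and \<open>v\<close> is the average
  of the two.\<close>

lemma norm_sq_le_norm_add:
  fixes v t :: "'a::c_star_algebra"
  assumes "star v * t = star t * v"
  shows "(norm v)\<^sup>2 \<le> norm (star v * v + star t * t)"
proof -
  define it where "it = \<i> *\<^sub>C t"
  have a: "star v * it + star it * v = 0"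
    by (simp add: it_def star_scaleC_ii mult_scaleC_left mult_scaleC_right assms)
  have b: "star it * it = star t * t"
    by (simp add: it_def star_scaleC_ii mult_scaleC_left mult_scaleC_right scaleC_ii_ii
        scaleC_minus_right)
  have p: "star (v + it) * (v + it) = star v * v + star t * t + (star v * it + star it * v)"
    by (simp add: star_simps algebra_simps b)
  have m: "star (v - it) * (v - it) = star v * v + star t * t - (star v * it + star it * v)"
    by (simp add: star_simps algebra_simps b)
  have "norm (v + it) = sqrt (norm (star v * v + star t * t))"
    "norm (v - it) = sqrt (norm (star v * v + star t * t))"
    using c_star_identity[of "v + it"] c_star_identity[of "v - it"] unfolding p m a
    by (simp_all add: real_sqrt_unique)
  moreover have "2 *\<^sub>R v = (v + it) + (v - it)" by (simp add: scaleR_2)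
  then have "2 * norm v \<le> norm (v + it) + norm (v - it)"
    by (metis norm_triangle_ineq norm_scaleR abs_numeral)
  ultimately have "norm v \<le> sqrt (norm (star v * v + star t * t))" by simp
  then show ?thesis
    by (metis norm_ge_zero power_mono real_sqrt_pow2)
qed

section \<open>Square roots without a unit\<close>

text \<open>Formally \<open>1 - hsqrt x\<close> is the square root of \<open>1 - x\<close>; no unit is needed to state
  this.\<close>

definition hsqrt :: "'a::c_star_algebra \<Rightarrow> 'a" where
  "hsqrt x = (THE s. norm s < 1 \<and> s + s - s * s = x)"

text \<open>An inverse Lipschitz bound from factoring the difference of two values of
  \<open>s + s - s * s\<close>. It yields both uniqueness of the root in the open unit ball and
  continuity of \<open>hsqrt\<close>.\<close>

lemma norm_hsqrt_diff_le:
  fixes s t :: "'a::real_normed_algebra"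
  shows "norm (s - t) * (2 - norm s - norm t) \<le> norm ((s + s - s * s) - (t + t - t * t))"
proof -
  have "2 *\<^sub>R (s - t) = ((s + s - s * s) - (t + t - t * t)) + (s * (s - t) + (s - t) * t)"
    by (simp add: scaleR_2 algebra_simps)
  then have "norm (2 *\<^sub>R (s - t)) \<le>
      norm ((s + s - s * s) - (t + t - t * t)) + norm (s * (s - t) + (s - t) * t)"
    by (metis norm_triangle_ineq)
  moreover have "norm (s * (s - t) + (s - t) * t) \<le> norm s * norm (s - t) + norm (s - t) * norm t"
    by (intro order_trans[OF norm_triangle_ineq] add_mono norm_mult_ineq)
  ultimately have "2 * norm (s - t) \<le> norm ((s + s - s * s) - (t + t - t * t)) +
      (norm s * norm (s - t) + norm (s - t) * norm t)"
    by (simp only: norm_scaleR)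
  then show ?thesis by (simp only: right_diff_distrib mult.commute)
qed

lemma hsqrt_eqI:
  fixes s :: "'a::c_star_algebra"
  assumes "norm s < 1" "s + s - s * s = x"
  shows "hsqrt x = s"
  unfolding hsqrt_def
proof (rule the_equality)
  fix t :: 'a assume t: "norm t < 1 \<and> t + t - t * t = x"
  have "norm (t - s) * (2 - norm t - norm s) \<le> 0"
    using norm_hsqrt_diff_le[of t s] t assms by simp
  moreover have "2 - norm t - norm s > 0" using t assms by linarith
  ultimately have "norm (t - s) \<le> 0" by (simp add: mult_le_0_iff)
  then show "t = s" by simp
qed (use assms in simp)

text \<open>Banach's fixed point theorem on the ball of radius \<open>r\<close>. The bound on
  \<open>norm x\<close> makes the ball invariant, as ((2 r - r^2) + r^2) / 2 = r, and
  \<open>r\<close> is also the contraction constant.\<close>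

lemma hsqrt_exists:
  fixes x :: "'a::c_star_algebra"
  assumes r: "0 \<le> r" "r < 1" and x: "norm x \<le> 2 * r - r\<^sup>2"
  shows "\<exists>s. norm s \<le> r \<and> s + s - s * s = x \<and> (\<forall>y. y * x = x * y \<longrightarrow> y * s = s * y)"
proof -
  \<comment> \<open>Intersecting with the closed set of elements that commute with whatever commutes
    with \<open>x\<close> passes this property on to the fixed point.\<close>
  define S where "S = cball (0::'a) r \<inter> (\<Inter>y\<in>{y. y * x = x * y}. {s. y * s = s * y})"
  define f where "f s = (1/2::real) *\<^sub>R (x + s * s)" for s :: 'a
  have "closed S" unfolding S_def
    by (intro closed_Int closed_cball closed_INT ballI closed_Collect_eq continuous_intros)
  then have "complete S" by (simp add: complete_eq_closed)
  moreover have "0 \<in> S" using r by (simp add: S_def)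
  then have "S \<noteq> {}" by blast
  moreover have "f s \<in> S" if s: "s \<in> S" for s
  proof -
    have "norm (s * s) \<le> r\<^sup>2"
      unfolding power2_eq_square using s r
      by (intro order_trans[OF norm_mult_ineq] mult_mono) (auto simp: S_def)
    then have "norm (f s) \<le> r"
      using x norm_triangle_ineq[of x "s * s"] by (simp add: f_def)
    moreover have "y * f s = f s * y" if "y * x = x * y" for y
    proof -
      have ys: "y * s = s * y" using s that by (simp add: S_def)
      have "y * (s * s) = s * s * y" by (metis ys mult.assoc)
      then show ?thesis by (simp add: f_def that distrib_left distrib_right)
    qed
    ultimately show ?thesis by (simp add: S_def)
  qed
  then have "f ` S \<subseteq> S" by blast
  moreover have "dist (f s) (f t) \<le> r * dist s t" if "s \<in> S" "t \<in> S" for s t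
  proof -
    have st: "norm s \<le> r" "norm t \<le> r" using that by (auto simp: S_def)
    have "f s - f t = (1/2::real) *\<^sub>R (s * (s - t) + (s - t) * t)"
      by (simp add: f_def algebra_simps)
    then have "norm (f s - f t) = norm (s * (s - t) + (s - t) * t) / 2" by simp
    also have "\<dots> \<le> (norm s * norm (s - t) + norm (s - t) * norm t) / 2"
      by (intro divide_right_mono order_trans[OF norm_triangle_ineq] add_mono norm_mult_ineq) simp
    also have "\<dots> \<le> (r * norm (s - t) + norm (s - t) * r) / 2"
      by (intro divide_right_mono add_mono mult_mono st) (use r in auto)
    finally show ?thesis by (simp add: dist_norm)
  qed
  ultimately have "\<exists>!s. s \<in> S \<and> f s = s"
    using Banach_fix[of S r f] r by blast
  then obtain s where s: "s \<in> S" "f s = s" by blast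
  have "s + s - s * s = x"
  proof -
    have "x + s * s = 2 *\<^sub>R f s" by (simp add: f_def)
    then show ?thesis using s(2) by (simp add: scaleR_2 algebra_simps)
  qed
  moreover have "norm s \<le> r" "\<forall>y. y * x = x * y \<longrightarrow> y * s = s * y"
    using s(1) unfolding S_def by simp_all
  ultimately show ?thesis by blast
qed

lemma
  fixes x :: "'a::c_star_algebra"
  assumes "norm x < 1"
  shows hsqrt_eq: "hsqrt x + hsqrt x - hsqrt x * hsqrt x = x"
    and norm_hsqrt_le: "norm (hsqrt x) \<le> norm x"
    and hsqrt_commute: "y * x = x * y \<Longrightarrow> y * hsqrt x = hsqrt x * y"
proof -
  have "norm x \<le> 2 * norm x - (norm x)\<^sup>2"
    using assms mult_left_le[of "norm x" "norm x"] by (simp add: power2_eq_square)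
  then obtain s where s: "norm s \<le> norm x" "s + s - s * s = x"
    "\<forall>y. y * x = x * y \<longrightarrow> y * s = s * y"
    using hsqrt_exists[OF norm_ge_zero assms] by blast
  have "hsqrt x = s" using s(1,2) assms by (intro hsqrt_eqI) auto
  then show "hsqrt x + hsqrt x - hsqrt x * hsqrt x = x" "norm (hsqrt x) \<le> norm x"
    "y * x = x * y \<Longrightarrow> y * hsqrt x = hsqrt x * y"
    using s by blast+
qed

lemma norm_hsqrt_less_1: "norm (x::'a::c_star_algebra) < 1 \<Longrightarrow> norm (hsqrt x) < 1"
  using norm_hsqrt_le[of x] by linarith

text \<open>Sharper than \<open>norm_hsqrt_le\<close>: the best choice is r = 1 - sqrt (1 - norm
  x).\<close>

lemma norm_hsqrt_le':
  fixes x :: "'a::c_star_algebra"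
  assumes "0 \<le> r" "r < 1" "norm x \<le> 2 * r - r\<^sup>2"
  shows "norm (hsqrt x) \<le> r"
proof -
  obtain s where s: "norm s \<le> r" "s + s - s * s = x" using hsqrt_exists[OF assms] by blast
  then have "hsqrt x = s" using assms(2) by (intro hsqrt_eqI) auto
  then show ?thesis using s by simp
qed

lemma star_hsqrt:
  fixes x :: "'a::c_star_algebra"
  assumes "norm x < 1"
  shows "star (hsqrt x) = hsqrt (star x)"
proof -
  have "star (hsqrt x) + star (hsqrt x) - star (hsqrt x) * star (hsqrt x) = star x"
    using arg_cong[OF hsqrt_eq[OF assms], of star] by (simp add: star_simps)
  then show ?thesis using norm_hsqrt_less_1[OF assms] by (intro hsqrt_eqI[symmetric]) auto
qed

lemma continuous_on_hsqrt:
  "continuous_on (ball 0 1) (hsqrt :: 'a::c_star_algebra \<Rightarrow> 'a)"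
proof (rule continuous_onI)
  fix x :: 'a and \<epsilon> :: real
  assume x: "x \<in> ball 0 1" and \<epsilon>: "\<epsilon> > 0"
  \<comment> \<open>A lower bound for 2 - norm (hsqrt y) - norm (hsqrt x), so \<open>hsqrt\<close>
    is Lipschitz at \<open>x\<close> with constant 1 / c.\<close>
  define c where "c = 1 - norm x"
  have c: "c > 0" using x by (simp add: c_def)
  show "\<exists>d>0. \<forall>y\<in>ball 0 1. dist y x < d \<longrightarrow> dist (hsqrt y) (hsqrt x) \<le> \<epsilon>"
  proof (intro exI conjI ballI impI)
    fix y :: 'a assume y: "y \<in> ball 0 1" and d: "dist y x < c * \<epsilon>"
    have n: "norm x < 1" "norm y < 1" using x y by auto
    have "norm (hsqrt y - hsqrt x) * c \<le>
        norm (hsqrt y - hsqrt x) * (2 - norm (hsqrt y) - norm (hsqrt x))"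
      using n norm_hsqrt_le[of x] norm_hsqrt_le[of y] by (intro mult_left_mono) (auto simp: c_def)
    also have "\<dots> \<le> norm (y - x)"
      using norm_hsqrt_diff_le[of "hsqrt y" "hsqrt x"] n by (simp add: hsqrt_eq)
    also have "\<dots> \<le> \<epsilon> * c" using d by (simp add: dist_norm mult.commute)
    finally show "dist (hsqrt y) (hsqrt x) \<le> \<epsilon>" using c by (simp add: dist_norm)
  qed (use c \<epsilon> in simp)
qed

section \<open>Norm estimates from square roots\<close>

text \<open>Formally f^2 + (1 - \<rho>)^2 = 1. Hence \<open>v = f * x\<close> and
  \<open>t = x - \<rho> * x\<close> satisfy \<open>star v * v + star t * t = star x * x\<close>, and
  \<open>norm_sq_le_norm_add\<close> bounds each of them.\<close>

lemma
  fixes f \<rho> x :: "'a::c_star_algebra"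
  assumes sa: "star f = f" "star \<rho> = \<rho>" and comm: "f * \<rho> = \<rho> * f"
    and sq: "\<rho> + \<rho> - \<rho> * \<rho> = f * f"
  shows norm_mult_le_of_square: "norm (f * x) \<le> norm x"
    and norm_diff_mult_le_of_square: "norm (x - \<rho> * x) \<le> norm x"
proof -
  define v t where "v = f * x" and "t = x - \<rho> * x"
  have c: "star v * t = star t * v"
  proof -
    have "star x * (f * (\<rho> * x)) = star x * (\<rho> * (f * x))" by (metis comm mult.assoc)
    then show ?thesis by (simp add: v_def t_def star_simps sa algebra_simps)
  qed
  have e: "star v * v + star t * t = star x * x"
  proof -
    have "star v * v = star x * ((\<rho> + \<rho> - \<rho> * \<rho>) * x)"
      by (simp add: v_def star_simps sa sq mult.assoc)
    then show ?thesis by (simp add: t_def star_simps sa algebra_simps)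
  qed
  have "(norm v)\<^sup>2 \<le> (norm x)\<^sup>2"
    using norm_sq_le_norm_add[OF c] e by (simp add: c_star_identity)
  then show "norm (f * x) \<le> norm x" unfolding v_def by (rule power2_le_imp_le) simp
  have "(norm t)\<^sup>2 \<le> (norm x)\<^sup>2"
    using norm_sq_le_norm_add[OF c[symmetric]] e by (simp add: c_star_identity add.commute)
  then show "norm (x - \<rho> * x) \<le> norm x" unfolding t_def by (rule power2_le_imp_le) simp
qed

text \<open>Multiplication by sqrt (1 - h^2) is a contraction; applying it twice gives
  multiplication by 1 - h^2.\<close>

lemma
  fixes h :: "'a::c_star_algebra"
  assumes h: "star h = h" "norm h < 1"
  shows norm_diff_hsqrt_square_le: "norm (x - hsqrt (h * h) * x) \<le> norm x"
    and norm_diff_square_le: "norm (x - h * h * x) \<le> norm x"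
    and norm_hsqrt_square_less_1: "norm (h * h) < 1"
proof -
  show n: "norm (h * h) < 1"
    using norm_mult_ineq[of h h] mult_left_le[of "norm h" "norm h"] h by (simp add: less_imp_le)
  define \<rho> where "\<rho> = hsqrt (h * h)"
  have r: "star \<rho> = \<rho>" "h * \<rho> = \<rho> * h" "\<rho> + \<rho> - \<rho> * \<rho> = h * h"
    unfolding \<rho>_def by (simp_all add: star_hsqrt[OF n] hsqrt_commute[OF n] hsqrt_eq[OF n]
        star_mult h mult.assoc)
  note b = norm_diff_mult_le_of_square[OF h(1) r]
  show "norm (x - hsqrt (h * h) * x) \<le> norm x" using b by (simp add: \<rho>_def)
  have "x - h * h * x = (x - \<rho> * x) - \<rho> * (x - \<rho> * x)"
    by (simp add: r(3)[symmetric] algebra_simps)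
  then show "norm (x - h * h * x) \<le> norm x" using b[of x] b[of "x - \<rho> * x"] by (simp only:)
qed

lemma norm_idempotent_le_1:
  fixes q :: "'a::c_star_algebra"
  assumes "star q = q" "q * q = q"
  shows "norm q \<le> 1"
proof -
  have "norm q * norm q = norm q"
    using c_star_identity[of q] assms by (simp add: power2_eq_square)
  then show ?thesis by (cases "norm q = 0") auto
qed

text \<open>Here \<open>q\<close> acts as a unit for \<open>k\<close>. For r < 1 the element
  \<open>q - r *\<^sub>R (q + k * k)\<close> is the square of a self-adjoint \<open>g\<close>, so r
  k^2 + g^2 = (1 - r) q, which bounds r (norm k)^2 by 1 - r.\<close>

lemma eq_0_of_norm_add_square_le_1:
  fixes q k :: "'a::c_star_algebra"
  assumes q: "star q = q" "q * q = q" and k: "star k = k" "q * k = k" "k * q = k"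
    and le: "norm (q + k * k) \<le> 1"
  shows "k = 0"
proof (rule ccontr)
  assume "k \<noteq> 0"
  define \<kappa> where "\<kappa> = (norm k)\<^sup>2"
  have \<kappa>: "\<kappa> > 0" using \<open>k \<noteq> 0\<close> by (simp add: \<kappa>_def)
  \<comment> \<open>With this choice r \<kappa> = 2 (1 - r), which contradicts r \<kappa> \<le> 1 -
    r.\<close>
  define r where "r = 2 / (2 + \<kappa>)"
  have r: "0 < r" "r < 1" using \<kappa> by (auto simp: r_def)
  define x where "x = r *\<^sub>R (q + k * k)"
  have nx: "norm x < 1"
    using r mult_left_mono[OF le, of r] unfolding x_def norm_scaleR by linarith
  define \<sigma> where "\<sigma> = hsqrt x"
  define g where "g = q - q * \<sigma>"
  have kk: "q * (k * k) = k * k" "k * k * q = k * k"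
    using k by (metis mult.assoc)+
  have xs: "star x = x" by (simp add: x_def star_simps q k)
  have "k * x = x * k"
    by (simp add: x_def k distrib_left distrib_right mult.assoc)
  then have k\<sigma>: "k * \<sigma> = \<sigma> * k" unfolding \<sigma>_def by (rule hsqrt_commute[OF nx])
  have qx: "q * x = x" "x * q = x"
    using kk by (simp_all add: x_def q distrib_left distrib_right)
  then have q\<sigma>: "q * \<sigma> = \<sigma> * q" unfolding \<sigma>_def by (intro hsqrt_commute[OF nx]) simp
  have \<sigma>s: "star \<sigma> = \<sigma>" by (simp add: \<sigma>_def star_hsqrt[OF nx] xs)
  have gs: "star g = g" by (simp add: g_def star_simps q \<sigma>s q\<sigma>)
  have gg: "g * g = (1 - r) *\<^sub>R q - r *\<^sub>R (k * k)"
  proof -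
    have a: "q * \<sigma> * q = q * \<sigma>" "q * \<sigma> * (q * \<sigma>) = q * (\<sigma> * \<sigma>)"
      using q q\<sigma> by (metis mult.assoc)+
    have "g * g = q - q * (\<sigma> + \<sigma> - \<sigma> * \<sigma>)"
      unfolding g_def left_diff_distrib right_diff_distrib a
      by (simp add: q mult.assoc[symmetric] distrib_left)
    also have "\<dots> = q - x" by (simp add: \<sigma>_def hsqrt_eq[OF nx] qx)
    finally show ?thesis by (simp add: x_def algebra_simps)
  qed
  define v where "v = sqrt r *\<^sub>R k"
  have kg: "k * g = g * k"
  proof -
    have "k * (q * \<sigma>) = q * \<sigma> * k" using k k\<sigma> by (metis mult.assoc)
    then show ?thesis by (simp add: g_def right_diff_distrib left_diff_distrib k)
  qed
  have "(norm v)\<^sup>2 \<le> norm (star v * v + star g * g)"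
    by (rule norm_sq_le_norm_add) (simp add: v_def star_simps k gs kg)
  also have "star v * v + star g * g = (1 - r) *\<^sub>R q"
    using r by (simp add: v_def star_simps k gs gg)
  also have "norm \<dots> \<le> (1 - r) * 1"
    using r norm_idempotent_le_1[OF q] by (simp add: mult_left_le)
  finally have "r * \<kappa> \<le> 1 - r" using r by (simp add: v_def \<kappa>_def power_mult_distrib)
  then have "\<kappa> * \<kappa> + \<kappa> * 2 \<le> 0" using \<kappa> by (simp add: r_def field_simps)
  moreover have "\<kappa> * \<kappa> > 0" using \<kappa> by simp
  ultimately show False using \<kappa> by linarith
qed

text \<open>The average of the squares of \<open>q + k\<close> and \<open>q - k\<close> is
  \<open>q + k * k\<close>.\<close>

lemma eq_0_of_norm_add_diff_le_1:
  fixes q k :: "'a::c_star_algebra"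
  assumes q: "star q = q" "q * q = q" and k: "star k = k" "q * k = k" "k * q = k"
    and le: "norm (q + k) \<le> 1" "norm (q - k) \<le> 1"
  shows "k = 0"
proof (rule eq_0_of_norm_add_square_le_1[OF q k])
  have "2 *\<^sub>R (q + k * k) = (q + k) * (q + k) + (q - k) * (q - k)"
    by (simp add: scaleR_2 algebra_simps q k)
  then have "2 * norm (q + k * k) \<le> norm ((q + k) * (q + k)) + norm ((q - k) * (q - k))"
    by (metis norm_triangle_ineq norm_scaleR abs_numeral)
  also have "\<dots> \<le> 1 * 1 + 1 * 1"
    by (intro add_mono order_trans[OF norm_mult_ineq] mult_mono le) auto
  finally show "norm (q + k * k) \<le> 1" by simp
qed

text \<open>\<open>f\<close> is the negative part of \<open>k\<close>. With \<open>y = w f\<close> both \<open>y\<^sup>* y\<close> and \<open>y y\<^sup>*\<close> are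
  negatives of projections, while their sum is \<open>2 ((Re y)\<^sup>2 + (Im y)\<^sup>2)\<close>.\<close>

lemma star_mult_self_idempotent:
  fixes w :: "'a::c_star_algebra"
  defines "k \<equiv> star w * w"
  assumes k3: "k * k * k = k"
  shows "k * k = k"
proof -
  define f where "f = (1/2::real) *\<^sub>R (k * k - k)"
  have ks: "star k = k" by (simp add: k_def star_simps)
  have fs: "star f = f" by (simp add: f_def star_simps ks)
  have k3': "k * (k * k) = k" "k * (k * (k * k)) = k * k"
    using k3 by (simp_all add: mult.assoc)
  have kf: "k * f = - f" by (simp add: f_def algebra_simps k3')
  have ff: "f * f = f"
  proof -
    have "f * f = (1/2::real) *\<^sub>R (k * (k * f) - k * f)"
      by (simp add: f_def algebra_simps)
    then show ?thesis by (simp add: kf scaleR_add_left[symmetric] flip: scaleR_2)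
  qed
  define y where "y = w * f"
  have yy: "star y * y = - f"
  proof -
    have "star y * y = f * (k * f)" by (simp add: y_def star_simps fs k_def mult.assoc)
    then show ?thesis by (simp add: kf ff)
  qed
  have yf: "y * f = y" by (simp add: y_def mult.assoc ff)
  define g where "g = - (y * star y)"
  have gs: "star g = g" by (simp add: g_def star_simps)
  have gg: "g * g = g"
  proof -
    have "g * g = y * (star y * y) * star y" by (simp add: g_def mult.assoc)
    then show ?thesis by (simp add: yy yf g_def)
  qed
  have nf: "norm f \<le> 1" and ng: "norm g \<le> 1" by (rule norm_idempotent_le_1; fact)+
  have ny: "norm y \<le> 1"
    using c_star_identity[of y] nf by (simp add: yy abs_square_le_1)
  \<comment> \<open>Real and imaginary part of \<open>y\<close>, and \<open>g\<close>, scaled to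
    have norm below 1 as \<open>norm_diff_square_le\<close> requires.\<close>
  define a b c where "a = (1/4::real) *\<^sub>R (y + star y)"
    and "b = (1/4::real) *\<^sub>R (\<i> *\<^sub>C (y - star y))" and "c = (1/2::real) *\<^sub>R g"
  have sa: "star a = a" "star b = b" "star c = c"
    by (simp_all add: a_def b_def c_def star_simps star_scaleC_ii gs add.commute
        flip: scaleC_minus_right)
  have "norm a \<le> 1/2" "norm b \<le> 1/2"
    using norm_triangle_ineq[of y "star y"] norm_triangle_ineq4[of y "star y"] ny
    by (simp_all add: a_def b_def norm_scaleC)
  then have n: "norm a < 1" "norm b < 1" "norm c < 1" using ng by (auto simp: c_def)
  have "16 *\<^sub>R (b * b) = - ((y - star y) * (y - star y))"
    by (simp add: b_def mult_scaleC_left mult_scaleC_right scaleC_scaleR scaleC_ii_ii)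
  moreover have "16 *\<^sub>R (a * a) = (y + star y) * (y + star y)" by (simp add: a_def)
  ultimately have ab2: "16 *\<^sub>R (a * a + b * b) = 2 *\<^sub>R (star y * y + y * star y)"
    unfolding scaleR_add_right by (simp add: scaleR_2 algebra_simps)
  have ab: "8 *\<^sub>R (a * a) + 8 *\<^sub>R (b * b) = - f - g"
    using arg_cong[OF ab2, of "scaleR (1/2)"] by (simp add: yy g_def scaleR_add_right)
  have s: "f = - 8 *\<^sub>R (a * a) - 8 *\<^sub>R (b * b) - 4 *\<^sub>R (c * c)"
    using arg_cong[OF ab, of "\<lambda>z. - z - g"] by (simp add: c_def gg)
  \<comment> \<open>Minus \<open>f\<close> is a combination of squares with total weight 8 + 8 + 4 =
    20. As \<open>f * f = f\<close>, the left side is \<open>21 *\<^sub>R f\<close>, while the right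
    side has norm at most 20 times that of \<open>f\<close>.\<close>
  have "20 *\<^sub>R f + f * f = 8 *\<^sub>R (f - a * a * f) + 8 *\<^sub>R (f - b * b * f) + 4 *\<^sub>R (f - c * c * f)"
    by (subst (2) s) (simp add: algebra_simps flip: scaleR_add_left)
  then have "norm (20 *\<^sub>R f + f * f) \<le> 8 * norm f + 8 * norm f + 4 * norm f"
    using norm_diff_square_le[OF sa(1) n(1), of f] norm_diff_square_le[OF sa(2) n(2), of f]
      norm_diff_square_le[OF sa(3) n(3), of f]
    by (simp only:) (intro order_trans[OF norm_triangle_ineq] add_mono; simp)
  moreover have "20 *\<^sub>R f + f * f = 21 *\<^sub>R f" 
    using scaleR_add_left[of 20 1 f] by (simp add: ff)
  ultimately have "f = 0" by simp
  then show ?thesis by (simp add: f_def)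
qed

section \<open>Kadison's characterisation of the extremal partial isometries\<close>

lemma extremal_partial_isometry_iff:
  fixes u :: "'a::c_star_algebra"
  shows "extremal_partial_isometry u \<longleftrightarrow>
    norm u \<le> 1 \<and> (\<forall>y. norm (u + y) \<le> 1 \<longrightarrow> norm (u - y) \<le> 1 \<longrightarrow> y = 0)"
proof (intro iffI conjI allI impI)
  assume u: "extremal_partial_isometry u"
  then show "norm u \<le> 1" by (simp add: extremal_partial_isometry_def extreme_point_of_def)
  fix y assume y: "norm (u + y) \<le> 1" "norm (u - y) \<le> 1"
  show "y = 0"
  proof (rule ccontr)
    assume "y \<noteq> 0"
    moreover have "(u + y) - (u - y) = 2 *\<^sub>R y" by (simp add: scaleR_2)
    ultimately have "u + y \<noteq> u - y"
      by (metis diff_self scaleR_eq_0_iff zero_neq_numeral)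
    moreover have "u = (1 - 1/2) *\<^sub>R (u + y) + (1/2) *\<^sub>R (u - y)"
      by (simp add: algebra_simps flip: scaleR_add_left)
    ultimately have "u \<in> open_segment (u + y) (u - y)"
      unfolding in_segment by (intro conjI exI[of _ "1/2"]) auto
    then show False
      using u y by (auto simp: extremal_partial_isometry_def extreme_point_of_def)
  qed
next
  assume u: "norm u \<le> 1 \<and> (\<forall>y. norm (u + y) \<le> 1 \<longrightarrow> norm (u - y) \<le> 1 \<longrightarrow> y = 0)"
  have "u \<notin> open_segment a b" if a: "norm a \<le> 1" and b: "norm b \<le> 1" for a b
  proof
    assume "u \<in> open_segment a b"
    then obtain t where t: "a \<noteq> b" "0 < t" "t < 1" "u = (1 - t) *\<^sub>R a + t *\<^sub>R b"
      by (auto simp: in_segment)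
    \<comment> \<open>The largest step for which \<open>u + d *\<^sub>R (b - a)\<close> and
      \<open>u - d *\<^sub>R (b - a)\<close> both stay on the segment.\<close>
    define d where "d = min t (1 - t)"
    have d: "0 < d" "d \<le> t" "d \<le> 1 - t" using t by (auto simp: d_def)
    have le: "norm ((1 - s) *\<^sub>R a + s *\<^sub>R b) \<le> 1" if "0 \<le> s" "s \<le> 1" for s
      using convexD_alt[OF convex_cball[of 0 1], of a b s] a b that by simp
    have "u + d *\<^sub>R (b - a) = (1 - (t + d)) *\<^sub>R a + (t + d) *\<^sub>R b"
      "u - d *\<^sub>R (b - a) = (1 - (t - d)) *\<^sub>R a + (t - d) *\<^sub>R b"
      by (simp_all add: t(4) algebra_simps)
    then have "norm (u + d *\<^sub>R (b - a)) \<le> 1" "norm (u - d *\<^sub>R (b - a)) \<le> 1"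
      using le[of "t + d"] le[of "t - d"] d by simp_all
    then have "d *\<^sub>R (b - a) = 0" using u by blast
    then show False using d t by simp
  qed
  then show "extremal_partial_isometry u"
    using u by (simp add: extremal_partial_isometry_def extreme_point_of_def)
qed

text \<open>The second conjunct says that \<open>(1 - u u\<^sup>*) x (1 - u\<^sup>* u) = 0\<close>, multiplied out
  because there is no unit yet.\<close>

definition kadison_condition :: "'a::c_star_algebra \<Rightarrow> bool" where
  "kadison_condition u \<longleftrightarrow> u * star u * u = u \<and>
     (\<forall>x. x - u * star u * x - x * (star u * u) + u * star u * x * (star u * u) = 0)"

text \<open>With \<open>k = u\<^sup>* u\<close> and \<open>\<phi>(k) = sqrt ((3 - k\<^sup>2) / 2)\<close> the elements \<open>u \<phi>(k)\<close> and
  \<open>2 u - u \<phi>(k)\<close> lie in the unit ball: for the former, \<open>F = k \<phi>(k)\<^sup>2\<close> satisfies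
  \<open>1 - F\<^sup>2 = (1 - k\<^sup>2)\<^sup>2 (1 - k\<^sup>2 / 4)\<close>. So extremality forces \<open>\<phi>(k)\<close> to fix \<open>u\<close>.\<close>

lemma extremal_imp_partial_isometry:
  fixes u :: "'a::c_star_algebra"
  assumes "extremal_partial_isometry u"
  shows "u * star u * u = u"
proof -
  have nu: "norm u \<le> 1" and ext: "\<And>y. norm (u + y) \<le> 1 \<Longrightarrow> norm (u - y) \<le> 1 \<Longrightarrow> y = 0"
    using assms by (auto simp: extremal_partial_isometry_iff)
  define k m where "k = star u * u" and "m = k * k"
  have ks: "star k = k" by (simp add: k_def star_simps)
  have ms: "star m = m" by (simp add: m_def star_simps ks)
  have km: "k * m = m * k" by (simp add: m_def mult.assoc)
  have nk: "norm k \<le> 1" using nu by (simp add: k_def c_star_identity power_le_one)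
  have nm: "norm m \<le> 1"
    using norm_mult_ineq[of k k] mult_mono[OF nk nk] unfolding m_def by simp
  \<comment> \<open>\<open>1 - \<sigma>\<close> is sqrt (1 - k^2 / 3), hence \<phi>(k) = sqrt (3/2)
    (1 - \<sigma>). The value of \<open>r\<close> solves 2 r - r^2 = 1/3 and makes the bound for
    \<open>2 *\<^sub>R u - up\<close> exactly 1.\<close>
  define x r \<sigma> where "x = (1/3::real) *\<^sub>R m" and "r = 1 - sqrt (2/3)" and "\<sigma> = hsqrt x"
  have nx: "norm x < 1" "norm x \<le> 1/3" using nm by (auto simp: x_def)
  have r: "0 \<le> r" "r < 1" "2 * r - r\<^sup>2 = 1/3" by (auto simp: r_def power2_eq_square algebra_simps)
  have n\<sigma>: "norm \<sigma> \<le> r" unfolding \<sigma>_def using r nx by (intro norm_hsqrt_le') auto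
  have "star x = x" by (simp add: x_def star_simps ms)
  then have \<sigma>s: "star \<sigma> = \<sigma>" by (simp add: \<sigma>_def star_hsqrt[OF nx(1)])
  have \<sigma>k: "k * \<sigma> = \<sigma> * k"
    unfolding \<sigma>_def by (rule hsqrt_commute[OF nx(1)]) (simp add: x_def km)
  have \<sigma>x: "\<sigma> + \<sigma> - \<sigma> * \<sigma> = x" unfolding \<sigma>_def by (rule hsqrt_eq[OF nx(1)])
  define up where "up = sqrt (3/2) *\<^sub>R (u - u * \<sigma>)"
  define F where "F = (3/2::real) *\<^sub>R k - (1/2::real) *\<^sub>R (k * m)"
  have up: "star up * up = F"
  proof -
    have "star (u - u * \<sigma>) * (u - u * \<sigma>) = k - \<sigma> * k - k * \<sigma> + \<sigma> * k * \<sigma>"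
      by (simp add: star_simps \<sigma>s k_def algebra_simps)
    also have "\<dots> = k - k * (\<sigma> + \<sigma> - \<sigma> * \<sigma>)"
      unfolding \<sigma>k[symmetric] by (simp add: algebra_simps)
    finally have "star (u - u * \<sigma>) * (u - u * \<sigma>) = k - k * x" by (simp only: \<sigma>x)
    moreover have "star up * up = (3/2::real) *\<^sub>R (star (u - u * \<sigma>) * (u - u * \<sigma>))"
      unfolding up_def star_scaleR mult_scaleR_left mult_scaleR_right scaleR_scaleR by simp
    ultimately show ?thesis by (simp add: F_def x_def scaleR_diff_right)
  qed
  have nup: "norm up \<le> 1"
  proof -
    have m4: "norm ((1/4::real) *\<^sub>R m) < 1" using nm by simp
    define s where "s = hsqrt ((1/4::real) *\<^sub>R m)"
    have ss: "star s = s" by (simp add: s_def star_hsqrt[OF m4] star_simps ms)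
    have s: "s + s - s * s = (1/4::real) *\<^sub>R m" unfolding s_def by (rule hsqrt_eq[OF m4])
    have sk: "k * s = s * k"
      unfolding s_def by (rule hsqrt_commute[OF m4]) (simp add: km)
    have sm: "m * s = s * m" unfolding m_def by (metis sk mult.assoc)
    \<comment> \<open>Chosen so that 1 - \<rho> = (1 - m) (1 - s), whose square is (1 - m)^2 (1 - m
      / 4) = 1 - F^2.\<close>
    define \<rho> where "\<rho> = m + s - m * s"
    have "\<rho> + \<rho> - \<rho> * \<rho> = (s + s - s * s) + (m + m) - m * m - m * (s + s - s * s)
        - m * (s + s - s * s) + m * m * (s + s - s * s)"
    proof -
      have sm': "s * m = m * s" "\<And>z. s * (m * z) = m * (s * z)"
        using sm by (simp, metis mult.assoc)
      show ?thesis by (simp add: \<rho>_def algebra_simps sm')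
    qed
    also have "\<dots> = (9/4::real) *\<^sub>R m - (3/2::real) *\<^sub>R (m * m) + (1/4::real) *\<^sub>R (m * m * m)"
    proof -
      have "m + m = 2 *\<^sub>R m" "(3/2) *\<^sub>R z = z + (1/2) *\<^sub>R z" for z :: 'a
        using scaleR_add_left[of 1 "1/2" z] by (simp_all add: scaleR_2)
      then show ?thesis unfolding s by (simp add: algebra_simps flip: scaleR_add_left)
    qed
    also have "\<dots> = F * F"
    proof -
      have "k * (k * m) = m * m" "k * m * k = m * m" "k * m * (k * m) = m * m * m" "k * k = m"
        by (simp_all add: m_def mult.assoc)
      moreover have "(3/2) *\<^sub>R (m * m) = (3/4) *\<^sub>R (m * m) + (3/4) *\<^sub>R (m * m)"
        by (simp flip: scaleR_add_left)
      ultimately show ?thesis unfolding F_def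
        by (simp add: left_diff_distrib right_diff_distrib scaleR_diff_right)
    qed
    finally have \<rho>: "\<rho> + \<rho> - \<rho> * \<rho> = F * F" .
    have "star F = F" by (simp add: F_def star_simps ks ms km)
    moreover have "star \<rho> = \<rho>" by (simp add: \<rho>_def star_simps ss ms sm)
    moreover have "F * \<rho> = \<rho> * F"
    proof -
      have "k * \<rho> = \<rho> * k"
        unfolding \<rho>_def distrib_left distrib_right left_diff_distrib right_diff_distrib
        by (metis km sk mult.assoc)
      moreover have "m * \<rho> = \<rho> * m" unfolding m_def by (metis calculation mult.assoc)
      ultimately have "k * m * \<rho> = \<rho> * (k * m)" by (metis mult.assoc)
      with \<open>k * \<rho> = \<rho> * k\<close> show ?thesis
        by (simp add: F_def left_diff_distrib right_diff_distrib)
    qed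
    ultimately have "norm (F * F) \<le> norm F" using \<rho> by (intro norm_mult_le_of_square)
    then have "(norm F)\<^sup>2 \<le> norm F" using c_star_identity[of F] \<open>star F = F\<close> by simp
    then have "norm F \<le> 1" by (cases "norm F = 0") (auto simp: power2_eq_square)
    then have "(norm up)\<^sup>2 \<le> 1" using c_star_identity[of up] by (simp add: up)
    then show ?thesis by (simp add: abs_square_le_1)
  qed
  have "norm (2 *\<^sub>R u - up) \<le> 1"
  proof -
    have q: "sqrt (3/2) * sqrt (2/3) = 1" by (simp flip: real_sqrt_mult)
    have q2: "sqrt (3/2) \<le> 2" by (rule real_le_lsqrt) auto
    have "2 *\<^sub>R u - up = (2 - sqrt (3/2)) *\<^sub>R u + sqrt (3/2) *\<^sub>R (u * \<sigma>)"
      by (simp add: up_def algebra_simps)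
    also have "norm \<dots> \<le> (2 - sqrt (3/2)) * norm u + sqrt (3/2) * (norm u * norm \<sigma>)"
      using q2 by (intro order_trans[OF norm_triangle_ineq] add_mono) (auto intro: norm_mult_ineq)
    also have "\<dots> \<le> (2 - sqrt (3/2)) * 1 + sqrt (3/2) * (1 * r)"
      using q2 nu n\<sigma> by (intro add_mono mult_mono) auto
    also have "\<dots> = 1" using q by (simp add: r_def algebra_simps)
    finally show ?thesis .
  qed
  \<comment> \<open>Extremality with \<open>y = up - u\<close>: then \<open>u + y = up\<close> and
    \<open>u - y = 2 *\<^sub>R u - up\<close>. Now \<open>F = k\<close> reads (3 k - k^3) / 2 = k,
    that is k^3 = k.\<close>
  then have "up - u = 0" using nup by (intro ext) (simp_all add: scaleR_2 algebra_simps)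
  then have "F = k" using up by (simp add: k_def)
  moreover have "3 *\<^sub>R k - 2 *\<^sub>R F = k * k * k"
    by (simp add: F_def scaleR_diff_right m_def mult.assoc)
  moreover have "3 *\<^sub>R k - 2 *\<^sub>R k = k" by (simp flip: scaleR_diff_left)
  ultimately have "k * k * k = k" by simp
  then have kk: "k * k = k" using star_mult_self_idempotent[of u] by (simp add: k_def)
  have "star (u - u * k) * (u - u * k) = k - k * k - k * k + k * k * k"
    by (simp add: star_simps k_def algebra_simps)
  then have "star (u - u * k) * (u - u * k) = 0" by (simp add: kk)
  then have "u - u * k = 0" by (simp only: star_mult_self_eq_0)
  then show ?thesis by (simp add: k_def mult.assoc)
qed

text \<open>Orthogonality survives squaring, so repeated use of the C*-identity bounds every power
  norm (a + b) ^ (2 ^ n) by 2, which is impossible for a base above 1.\<close>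

lemma norm_add_orthogonal_le_1:
  fixes a b :: "'a::c_star_algebra"
  assumes "star a = a" "star b = b" "a * b = 0" "norm a \<le> 1" "norm b \<le> 1"
  shows "norm (a + b) \<le> 1"
proof (rule ccontr)
  have pow: "norm (a + b) ^ (2 ^ n) \<le> 2"
    if "star a = a" "star b = b" "a * b = 0" "norm a \<le> 1" "norm b \<le> 1" for n and a b :: 'a
    using that
  proof (induction n arbitrary: a b)
    case 0
    then show ?case using norm_triangle_ineq[of a b] by simp
  next
    case (Suc n)
    have ba: "b * a = 0" using star_mult[of a b] Suc.prems by simp
    have "(norm (a + b))\<^sup>2 = norm (a * a + b * b)"
      using c_star_identity[of "a + b"] Suc.prems ba
      by (simp add: star_simps algebra_simps)
    moreover have "norm (a * a + b * b) ^ (2 ^ n) \<le> 2"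
    proof (rule Suc.IH)
      show "a * a * (b * b) = 0" using Suc.prems(3) by (metis mult.assoc mult_zero_left mult_zero_right)
      show "norm (a * a) \<le> 1" "norm (b * b) \<le> 1"
        using c_star_identity[of a] c_star_identity[of b] Suc.prems by (simp_all add: power_le_one)
    qed (simp_all add: star_simps Suc.prems)
    ultimately show ?case by (simp add: power_mult)
  qed
  assume "\<not> norm (a + b) \<le> 1"
  then have c: "norm (a + b) > 1" by simp
  obtain n where "2 < norm (a + b) ^ n" using real_arch_pow[OF c] by blast
  also have "\<dots> \<le> norm (a + b) ^ (2 ^ n)"
    using c by (intro power_increasing) (auto intro: less_imp_le)
  finally show False using pow[OF assms, of n] by simp
qed

text \<open>A nonzero element of (1 - u \<open>star u\<close>) A (1 - \<open>star u\<close> u),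
  normalised to \<open>z\<close>, is orthogonal to \<open>u\<close> on both sides. Then
  \<open>u + z\<close> and \<open>u - z\<close> lie in the unit ball, because
  \<open>star u * u\<close> and \<open>star z * z\<close> are orthogonal contractions.\<close>

lemma extremal_imp_kadison_condition:
  fixes u :: "'a::c_star_algebra"
  assumes "extremal_partial_isometry u"
  shows "kadison_condition u"
  unfolding kadison_condition_def
proof (intro conjI allI)
  show u: "u * star u * u = u" by (rule extremal_imp_partial_isometry[OF assms])
  have u': "u * (star u * u) = u" using u by (simp add: mult.assoc)
  have us: "star u * u * star u = star u" "star u * (u * star u) = star u"
    using arg_cong[OF u, of star] by (simp_all add: star_simps mult.assoc)
  fix x
  define y where "y = x - u * star u * x - x * (star u * u) + u * star u * x * (star u * u)"
  have uy: "star u * y = 0"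
  proof -
    have "star u * (u * (star u * z)) = star u * z" for z using us by (metis mult.assoc)
    then show ?thesis by (simp add: y_def algebra_simps)
  qed
  have yq: "y * (star u * u) = 0"
  proof -
    have "star u * (u * (star u * u)) = star u * u" using us by (metis mult.assoc)
    then show ?thesis by (simp add: y_def algebra_simps)
  qed
  have qq: "star u * u * (star u * u) = star u * u" using u' by (simp add: mult.assoc)
  show "y = 0"
  proof (rule ccontr)
    assume "y \<noteq> 0"
    define z where "z = (1 / norm y) *\<^sub>R y"
    have nz: "norm z = 1" using \<open>y \<noteq> 0\<close> by (simp add: z_def)
    have uz: "star u * z = 0" "star z * u = 0" and zq: "z * (star u * u) = 0" "star u * u * star z = 0"
      using uy yq star_mult[of "star u" y] star_mult[of y "star u * u"]
      by (simp_all add: z_def star_simps)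
    have "norm (star u * u + star z * z) \<le> 1"
    proof (rule norm_add_orthogonal_le_1)
      show "star u * u * (star z * z) = 0" using zq by (metis mult.assoc mult_zero_left)
      show "norm (star u * u) \<le> 1" by (rule norm_idempotent_le_1) (simp_all add: star_simps qq)
    qed (simp_all add: star_simps c_star_identity nz)
    moreover have "star (u + z) * (u + z) = star u * u + star z * z"
      "star (u - z) * (u - z) = star u * u + star z * z"
      by (simp_all add: star_simps algebra_simps uz)
    ultimately have "(norm (u + z))\<^sup>2 \<le> 1" "(norm (u - z))\<^sup>2 \<le> 1"
      by (simp_all flip: c_star_identity)
    then have "norm (u + z) \<le> 1" "norm (u - z) \<le> 1" by (simp_all add: abs_square_le_1)
    then have "z = 0" using assms by (simp add: extremal_partial_isometry_iff)
    then show False using nz by simp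
  qed
qed

text \<open>Compress to the support projection \<open>q\<close>: \<open>u + z\<close> and
  \<open>u - z\<close> with \<open>z = y * q\<close> remain in the unit ball, and averages of their
  products are \<open>q + k\<close> and \<open>q - k\<close> with
  \<open>k = star z * z\<close>.\<close>

lemma mult_support_eq_0:
  fixes u y :: "'a::c_star_algebra"
  assumes u: "u * star u * u = u" and y: "norm (u + y) \<le> 1" "norm (u - y) \<le> 1"
  shows "y * (star u * u) = 0"
proof -
  define q z k where "q = star u * u" and "z = y * q" and "k = star z * z"
  have uq: "u * q = u" using u by (simp add: q_def mult.assoc)
  have qq: "q * q = q" using uq by (simp add: q_def mult.assoc)
  have qs: "star q = q" by (simp add: q_def star_simps)
  have nq: "norm q \<le> 1" by (rule norm_idempotent_le_1[OF qs qq])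
  have ab: "norm (u + z) \<le> 1" "norm (u - z) \<le> 1"
  proof -
    have "u + z = (u + y) * q" "u - z = (u - y) * q"
      by (simp_all add: z_def distrib_right left_diff_distrib uq)
    then show "norm (u + z) \<le> 1" "norm (u - z) \<le> 1"
      using norm_mult_ineq[of "u + y" q] norm_mult_ineq[of "u - y" q]
        mult_mono[OF y(1) nq] mult_mono[OF y(2) nq] by simp_all
  qed
  have le: "norm (star a * b) \<le> 1" if "norm a \<le> 1" "norm b \<le> 1" for a b :: 'a
    using norm_mult_ineq[of "star a" b] mult_mono[OF that] by simp
  have "2 *\<^sub>R (q + k) = star (u + z) * (u + z) + star (u - z) * (u - z)"
    "2 *\<^sub>R (q - k) = star (u + z) * (u - z) + star (u - z) * (u + z)"
    by (simp_all add: scaleR_2 star_simps algebra_simps q_def k_def)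
  then have "2 * norm (q + k) \<le> norm (star (u + z) * (u + z)) + norm (star (u - z) * (u - z))"
    "2 * norm (q - k) \<le> norm (star (u + z) * (u - z)) + norm (star (u - z) * (u + z))"
    by (metis norm_triangle_ineq norm_scaleR abs_numeral)+
  then have "norm (q + k) \<le> 1" "norm (q - k) \<le> 1"
    using le[OF ab(1) ab(1)] le[OF ab(2) ab(2)] le[OF ab(1) ab(2)] le[OF ab(2) ab(1)] by linarith+
  moreover have "star k = k" "q * k = k" "k * q = k"
    by (simp_all add: k_def z_def star_simps qs qq mult.assoc) (simp add: qq flip: mult.assoc)
  ultimately have "k = 0" by (intro eq_0_of_norm_add_diff_le_1[OF qs qq])
  then show ?thesis by (simp add: k_def star_mult_self_eq_0 z_def q_def)
qed

lemma kadison_condition_imp_extremal: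
  fixes u :: "'a::c_star_algebra"
  assumes "kadison_condition u"
  shows "extremal_partial_isometry u"
  unfolding extremal_partial_isometry_iff
proof (intro conjI allI impI)
  have u: "u * star u * u = u"
    and c: "\<And>x. x - u * star u * x - x * (star u * u) + u * star u * x * (star u * u) = 0"
    using assms by (auto simp: kadison_condition_def)
  have us: "star u * star (star u) * star u = star u"
    using arg_cong[OF u, of star] by (simp add: star_simps mult.assoc)
  have "norm (star u * u) \<le> 1"
    using us by (intro norm_idempotent_le_1) (simp_all add: star_simps flip: mult.assoc)
  then have "(norm u)\<^sup>2 \<le> 1" by (simp add: c_star_identity)
  then show "norm u \<le> 1" by (simp add: abs_square_le_1)
  fix y assume y: "norm (u + y) \<le> 1" "norm (u - y) \<le> 1"
  have 1: "y * (star u * u) = 0" by (rule mult_support_eq_0[OF u y])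
  have "norm (star u + star y) \<le> 1" "norm (star u - star y) \<le> 1"
    using y norm_star[of "u + y"] norm_star[of "u - y"] by (simp_all add: star_simps)
  then have "star y * (star (star u) * star u) = 0" by (rule mult_support_eq_0[OF us])
  from arg_cong[OF this, of star] have 2: "u * star u * y = 0" by (simp add: star_simps)
  \<comment> \<open>Perturbing \<open>u\<close> and \<open>star u\<close> has shown that
    \<open>y\<close> vanishes against both supports, so only the term \<open>y\<close> of Kadison's
    condition remains.\<close>
  show "y = 0" using c[of y] by (simp add: 1 2)
qed

text \<open>The condition (1 - p) A (1 - q) = 0 suggests (1 - p) (1 - q) = 0, so that the unit is
  \<open>p + q - p * q\<close>. For y = (1 - p) (1 - q) x it gives \<open>y * star y = 0\<close>;
  the other side is symmetric.\<close>

lemma kadison_condition_imp_unit: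
  fixes u :: "'a::c_star_algebra"
  assumes "kadison_condition u"
  shows "\<exists>e::'a. \<forall>x. e * x = x \<and> x * e = x"
proof -
  define p q where "p = u * star u" and "q = star u * u"
  have c: "\<And>x. x - p * x - x * q + p * x * q = 0"
    using assms by (auto simp: kadison_condition_def p_def q_def)
  have ps: "star p = p" and qs: "star q = q" by (simp_all add: p_def q_def star_simps)
  have "(p + q - p * q) * x = x" for x
  proof -
    define z where "z = x - q * x"
    define y where "y = z - p * z"
    have "(z - p * z) * (star x - star x * q) =
        z * star x - p * (z * star x) - z * star x * q + p * (z * star x) * q"
      by (simp add: algebra_simps)
    also have "\<dots> = 0" by (rule c)
    finally have "y * (star x - star x * q) = 0" by (simp add: y_def)
    moreover have "star y = (star x - star x * q) - (star x - star x * q) * p"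
      by (simp add: y_def z_def star_simps ps qs algebra_simps)
    ultimately have "y * star y = 0"
      by (metis diff_self mult.assoc mult_zero_left right_diff_distrib)
    then have "y = 0" using star_mult_self_eq_0[of "star y"] star_star[of y]
      by (metis star_zero)
    then show ?thesis by (simp add: y_def z_def algebra_simps)
  qed
  moreover have "x * (p + q - p * q) = x" for x
  proof -
    define z where "z = x - x * p"
    define y where "y = z - z * q"
    have "(star x - p * star x) * (z - z * q) =
        star x * z - p * (star x * z) - star x * z * q + p * (star x * z) * q"
      by (simp add: algebra_simps)
    also have "\<dots> = 0" by (rule c)
    finally have "(star x - p * star x) * y = 0" by (simp add: y_def)
    moreover have "star y = (star x - p * star x) - q * (star x - p * star x)"
      by (simp add: y_def z_def star_simps ps qs algebra_simps)
    ultimately have "star y * y = 0"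
      by (metis diff_self mult.assoc mult_zero_right left_diff_distrib)
    then have "y = 0" by (simp add: star_mult_self_eq_0)
    then show ?thesis by (simp add: y_def z_def algebra_simps)
  qed
  ultimately show ?thesis by blast
qed

section \<open>Inverses and projections in a unital algebra\<close>

text \<open>The unit is a parameter, as the class \<open>c_star_algebra\<close> does not provide one.\<close>

locale c_star_unit =
  fixes I :: "'a::c_star_algebra"
  assumes unit_left [simp]: "I * x = x" and unit_right [simp]: "x * I = x"
begin

lemma star_unit [simp]: "star I = I"
  using star_mult[of I "star I"] by (simp add: star_star)

lemma norm_unit_le_1: "norm I \<le> 1"
  by (rule norm_idempotent_le_1) simp_all

definition inverts :: "'a \<Rightarrow> 'a \<Rightarrow> bool" where
  "inverts a b \<longleftrightarrow> a * b = I \<and> b * a = I"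

definition cinv :: "'a \<Rightarrow> 'a" where
  "cinv a = (THE b. inverts a b)"

lemma inverts_unique:
  assumes "b * a = I" "a * c = I"
  shows "b = c"
  by (metis assms mult.assoc unit_left unit_right)

lemma cinv_eq:
  assumes "inverts a b"
  shows "cinv a = b"
  unfolding cinv_def
  using assms by (intro the_equality) (auto simp: inverts_def intro: inverts_unique)

lemma inverts_cinv: "inverts a b \<Longrightarrow> inverts a (cinv a)"
  by (simp add: cinv_eq)

text \<open>A Neumann series in fixed point form, giving a right and a left inverse
  separately.\<close>

lemma inverts_exists:
  assumes "norm (I - a) < 1"
  shows "\<exists>b. inverts a b"
proof -
  have "\<exists>!b. I + (I - a) * b = b"
  proof (rule banach_fix_type[OF norm_ge_zero assms], intro allI)
    fix b c
    have "I + (I - a) * b - (I + (I - a) * c) = (I - a) * (b - c)" by (simp add: algebra_simps)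
    then show "dist (I + (I - a) * b) (I + (I - a) * c) \<le> norm (I - a) * dist b c"
      unfolding dist_norm by (simp only: norm_mult_ineq)
  qed
  then obtain b where "I + (I - a) * b = b" by blast
  then have b: "a * b = I" by (simp add: algebra_simps)
  have "\<exists>!b. I + b * (I - a) = b"
  proof (rule banach_fix_type[OF norm_ge_zero assms], intro allI)
    fix b c
    have "I + b * (I - a) - (I + c * (I - a)) = (b - c) * (I - a)" by (simp add: algebra_simps)
    then show "dist (I + b * (I - a)) (I + c * (I - a)) \<le> norm (I - a) * dist b c"
      unfolding dist_norm by (metis norm_mult_ineq mult.commute)
  qed
  then obtain c where "I + c * (I - a) = c" by blast
  then have c: "c * a = I" by (simp add: algebra_simps)
  show ?thesis using b c inverts_unique[OF c b] by (auto simp: inverts_def)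
qed

lemma inverts_star: "inverts a b \<Longrightarrow> inverts (star a) (star b)"
  unfolding inverts_def by (metis star_mult star_unit)

lemma inverts_commute:
  assumes "inverts a b" "y * a = a * y"
  shows "y * b = b * y"
  using assms unfolding inverts_def by (metis mult.assoc unit_left unit_right)

lemma inverts_commute_swap:
  assumes "inverts a b" "y * a = a * z"
  shows "b * y = z * b"
  using assms unfolding inverts_def by (metis mult.assoc unit_left unit_right)

lemma inverts_scaleR: "inverts (c *\<^sub>R a) b \<Longrightarrow> inverts a (c *\<^sub>R b)"
  by (simp add: inverts_def)

text \<open>The resolvent identity \<open>g s - g t = g s * (f t - f s) * g t\<close>, where
  \<open>g s\<close> has norm at most \<open>2 * norm (g t)\<close> for \<open>s\<close> near
  \<open>t\<close>.\<close>

lemma continuous_on_cinv: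
  assumes f: "continuous_on S f" and inv: "\<And>s. s \<in> S \<Longrightarrow> \<exists>b. inverts (f s) b"
  shows "continuous_on S (\<lambda>s. cinv (f s))"
  unfolding continuous_on_def
proof
  fix t assume t: "t \<in> S"
  define g where "g s = cinv (f s)" for s
  have g: "f s * g s = I" "g s * f s = I" if "s \<in> S" for s
    using inv[OF that] inverts_cinv[of "f s"] by (auto simp: g_def inverts_def)
  have lim: "((\<lambda>s. norm (f t - f s)) \<longlongrightarrow> 0) (at t within S)"
    using f t tendsto_norm[OF tendsto_diff[OF tendsto_const[of "f t"], of f "f t" "at t within S"]]
    by (simp add: continuous_on_def)
  have "((\<lambda>s. norm (f t - f s) * norm (g t)) \<longlongrightarrow> 0) (at t within S)"
    using tendsto_mult_right[OF lim, of "norm (g t)"] by simp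
  then have "\<forall>\<^sub>F s in at t within S. norm (f t - f s) * norm (g t) < 1/2"
    by (rule order_tendstoD) simp
  moreover have "\<forall>\<^sub>F s in at t within S. s \<in> S" by (simp add: eventually_at_filter)
  ultimately have "\<forall>\<^sub>F s in at t within S. norm (g s - g t) \<le> 2 * (norm (g t))\<^sup>2 * norm (f t - f s)"
  proof eventually_elim
    case (elim s)
    have "g s - g t = g s * (f t - f s) * g t"
      using g[OF t] g[OF elim(2)] by (simp add: left_diff_distrib right_diff_distrib mult.assoc)
    then have "norm (g s - g t) \<le> norm (g s * (f t - f s)) * norm (g t)"
      by (simp only: norm_mult_ineq)
    also have "\<dots> \<le> norm (g s) * norm (f t - f s) * norm (g t)"
      by (intro mult_right_mono norm_mult_ineq norm_ge_zero)
    finally have le: "norm (g s - g t) \<le> norm (g s) * (norm (f t - f s) * norm (g t))"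
      by (simp only: mult.assoc)
    also have "\<dots> \<le> norm (g s) * (1/2)" using elim(1) by (intro mult_left_mono) auto
    finally have "norm (g s) \<le> 2 * norm (g t)"
      using norm_triangle_ineq2[of "g s" "g t"] by simp
    then have "norm (g s) * (norm (f t - f s) * norm (g t)) \<le>
        2 * norm (g t) * (norm (f t - f s) * norm (g t))"
      by (intro mult_right_mono) auto
    with le show ?case by (simp add: power2_eq_square mult_ac)
  qed
  moreover have "((\<lambda>s. 2 * (norm (g t))\<^sup>2 * norm (f t - f s)) \<longlongrightarrow> 0) (at t within S)"
    using tendsto_mult_left[OF lim, of "2 * (norm (g t))\<^sup>2"] by simp
  ultimately have "((\<lambda>s. g s - g t) \<longlongrightarrow> 0) (at t within S)" by (rule Lim_null_comparison)
  then show "((\<lambda>s. cinv (f s)) \<longlongrightarrow> cinv (f t)) (at t within S)"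
    unfolding g_def by (rule LIM_zero_cancel)
qed

lemma norm_unit_diff_square_le_1:
  assumes "star h = h" "norm h < 1"
  shows "norm (I - h * h) \<le> 1"
  using norm_diff_square_le[OF assms, of I] norm_unit_le_1 by simp

text \<open>Replaces a spectral argument: \<open>c\<close> makes \<open>c *\<^sub>R s\<close> a
  strict contraction, and \<mu> is tuned so that 1 - \<mu> (1 + s^2) = (1 - c^2 s^2) / (1 + c^2), of
  norm below 1.\<close>

lemma inverts_unit_add_square_exists:
  assumes s: "star s = s"
  shows "\<exists>b. inverts (I + s * s) b"
proof -
  define c :: real where "c = 1 / (1 + norm s)"
  define \<mu> where "\<mu> = c\<^sup>2 / (1 + c\<^sup>2)"
  have c: "c > 0" by (simp add: c_def add_pos_nonneg)
  then have c2: "1 + c\<^sup>2 > 1" by simp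
  have "norm (c *\<^sub>R s) < 1" by (simp add: c_def add_pos_nonneg)
  then have "norm (I - c\<^sup>2 *\<^sub>R (s * s)) \<le> 1"
    using norm_unit_diff_square_le_1[of "c *\<^sub>R s"] s by (simp add: star_simps power2_eq_square)
  moreover have "I - \<mu> *\<^sub>R (I + s * s) = (1 / (1 + c\<^sup>2)) *\<^sub>R (I - c\<^sup>2 *\<^sub>R (s * s))"
  proof -
    have "1 / (1 + c\<^sup>2) + c\<^sup>2 / (1 + c\<^sup>2) = 1"
      using c2 unfolding add_divide_distrib[symmetric] by (intro divide_self) linarith
    then have "1 - \<mu> = 1 / (1 + c\<^sup>2)" by (simp add: \<mu>_def)
    moreover have "I - \<mu> *\<^sub>R (I + s * s) = (1 - \<mu>) *\<^sub>R I - \<mu> *\<^sub>R (s * s)"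
      by (simp add: algebra_simps)
    ultimately show ?thesis by (simp add: \<mu>_def scaleR_diff_right)
  qed
  ultimately have "norm (I - \<mu> *\<^sub>R (I + s * s)) \<le> 1 / (1 + c\<^sup>2)"
    using c2 by (simp add: divide_right_mono)
  also have "\<dots> < 1" using c2 by (subst divide_less_eq_1_pos) linarith+
  finally show ?thesis using inverts_exists inverts_scaleR by blast
qed

section \<open>Range projections of idempotents and kernel projections\<close>

text \<open>For an idempotent \<open>d\<close>, \<open>(d + d\<^sup>* - 1)\<^sup>2 = 1 + s\<^sup>2\<close> with the self-adjoint
  \<open>s = \<i> (d - d\<^sup>*)\<close>, so \<open>d + d\<^sup>* - 1\<close> is invertible.\<close>

lemma inverts_idempotent_exists:
  assumes d: "d * d = d"
  shows "\<exists>b. inverts (d + star d - I) b"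
proof -
  define j s where "j = d + star d - I" and "s = \<i> *\<^sub>C (d - star d)"
  have ds: "star d * star d = star d" by (simp add: d flip: star_mult)
  have "star s = s"
    by (simp add: s_def star_scaleC_ii star_simps flip: scaleC_minus_right)
  then obtain b where b: "inverts (I + s * s) b" using inverts_unit_add_square_exists by blast
  have "s * s = - ((d - star d) * (d - star d))"
    by (simp add: s_def mult_scaleC_left mult_scaleC_right scaleC_ii_ii)
  then have "I + s * s = j * j"
    by (simp add: j_def left_diff_distrib right_diff_distrib distrib_left distrib_right d ds)
  then have "j * (j * b) = I" "(b * j) * j = I" using b by (simp_all add: inverts_def mult.assoc)
  moreover from this have "b * j = j * b" by (intro inverts_unique[of "b * j" j])
  ultimately have "inverts j (j * b)" by (simp add: inverts_def)
  then show ?thesis by (auto simp: j_def)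
qed

text \<open>For idempotent \<open>d\<close> this is the self-adjoint projection with the same range
  as \<open>d\<close>.\<close>

definition range_proj :: "'a \<Rightarrow> 'a" where
  "range_proj d = d * cinv (d + star d - I)"

lemma range_proj:
  assumes d: "d * d = d"
  shows "star (range_proj d) = range_proj d" "d * range_proj d = range_proj d"
    "range_proj d * d = d"
proof -
  define j b where "j = d + star d - I" and "b = cinv (d + star d - I)"
  have b: "inverts j b"
    using inverts_idempotent_exists[OF d] inverts_cinv by (auto simp: j_def b_def)
  have ds: "star d * star d = star d" by (simp add: d flip: star_mult)
  have dj: "d * j = d * star d" "j * star d = d * star d" "star d * j = star d * d" "j * d = star d * d"
    by (simp_all add: j_def left_diff_distrib right_diff_distrib distrib_left distrib_right d ds)
  have e: "range_proj d = d * b" by (simp add: range_proj_def b_def)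
  have "star j = j" by (simp add: j_def star_simps add.commute)
  then have bs: "star b = b"
    using cinv_eq[OF b] cinv_eq[OF inverts_star[OF b]] by simp
  \<comment> \<open>\<open>j\<close> intertwines \<open>d\<close> and \<open>star d\<close>, hence
    so does its inverse \<open>b\<close>.\<close>
  have bd: "b * d = star d * b" "b * star d = d * b"
    by (rule inverts_commute_swap[OF b]; simp add: dj)+
  show "star (range_proj d) = range_proj d" by (simp add: e star_mult bs bd)
  show "d * range_proj d = range_proj d" by (simp add: e d flip: mult.assoc)
  have "d * b * d = d * star d * b" by (simp add: mult.assoc bd)
  also have "\<dots> = d" using b by (simp add: dj(1)[symmetric] mult.assoc inverts_def)
  finally show "range_proj d * d = d" by (simp add: e)
qed

text \<open>Specified through \<open>x\<close> alone rather than through a generalised inverse, so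
  that the polar part does not depend on which extremal partial isometry is near
  \<open>x\<close>.\<close>

definition ker_proj :: "'a \<Rightarrow> 'a" where
  "ker_proj x = (THE e. star e = e \<and> x * e = 0 \<and> (\<forall>y. x * y = 0 \<longrightarrow> e * y = y))"

lemma ker_proj_eqI:
  assumes e: "star e = e" "x * e = 0" "\<And>y. x * y = 0 \<Longrightarrow> e * y = y"
  shows "ker_proj x = e"
  unfolding ker_proj_def
proof (rule the_equality)
  fix f assume f: "star f = f \<and> x * f = 0 \<and> (\<forall>y. x * y = 0 \<longrightarrow> f * y = y)"
  have "e * f = f" "f * e = e" using e f by auto
  then show "f = e" using star_mult[of e f] e f by simp
qed (use e in auto)

lemma range_proj_ker:
  assumes x: "x * n * x = x"
  defines "d \<equiv> I - n * x"
  shows "d * d = d" "x * range_proj d = 0" "\<And>y. x * y = 0 \<Longrightarrow> range_proj d * y = y"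
    "ker_proj x = range_proj d"
proof -
  have xd: "x * d = 0" using x by (simp add: d_def right_diff_distrib mult.assoc)
  show dd: "d * d = d" using xd by (simp add: d_def left_diff_distrib right_diff_distrib mult.assoc)
  note e = range_proj[OF dd]
  show 1: "x * range_proj d = 0" using e(2) xd by (metis mult.assoc mult_zero_left)
  show 2: "range_proj d * y = y" if "x * y = 0" for y
  proof -
    have "d * y = y" using that by (simp add: d_def left_diff_distrib mult.assoc)
    then show ?thesis using e(3) by (metis mult.assoc)
  qed
  show "ker_proj x = range_proj d" by (rule ker_proj_eqI[OF e(1) 1 2])
qed

text \<open>The inverse is built from the Moore--Penrose inverse \<open>m\<close> of \<open>x\<close>.\<close>

lemma inverts_square_add_ker_proj:
  assumes x: "x * n * x = x"
  shows "\<exists>b. inverts (star x * x + ker_proj x) b"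
proof -
  \<comment> \<open>\<open>e\<close> and \<open>r\<close> project onto the kernel and the range of
    \<open>x\<close>; cutting \<open>n\<close> down by them gives \<open>x * m = r\<close> and
    \<open>m * x = I - e\<close>. The inverse sought is \<open>m * star m + e\<close>.\<close>
  define d e r m where "d = I - n * x" and "e = range_proj d" and "r = range_proj (x * n)"
    and "m = (I - e) * n * r"
  have dd: "d * d = d" and xe: "x * e = 0" and ke: "ker_proj x = e"
    using range_proj_ker[OF x] by (auto simp: d_def e_def)
  have es: "star e = e" and ed: "e * d = d" and de: "d * e = e"
    using range_proj[OF dd] by (auto simp: e_def)
  have xn: "x * n * (x * n) = x * n" using x by (metis mult.assoc)
  have rs: "star r = r" and rxn: "r * (x * n) = x * n" and xnr: "x * n * r = r"
    using range_proj[OF xn] by (auto simp: r_def)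
  have rr: "r * r = r" using rxn xnr by (metis mult.assoc)
  have rx: "r * x = x" using rxn x by (metis mult.assoc)
  have ee: "e * e = e" using ed de by (metis mult.assoc)
  have xm: "x * m = r"
    using xnr xe by (simp add: m_def left_diff_distrib right_diff_distrib flip: mult.assoc)
  have mx: "m * x = I - e"
  proof -
    have "m * x = (I - e) * (n * x)" using rx by (simp add: m_def mult.assoc)
    also have "n * x = I - d" by (simp add: d_def)
    also have "(I - e) * (I - d) = I - e" by (simp add: left_diff_distrib right_diff_distrib ed)
    finally show ?thesis .
  qed
  have em: "e * m = 0" by (simp add: m_def right_diff_distrib left_diff_distrib ee flip: mult.assoc)
  have sxe: "e * star x = 0" using star_mult[of x e] xe es by simp
  have me: "star m * e = 0" using star_mult[of e m] em es by simp
  have "star x * x * (m * star m) = star (m * (r * x))"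
    using xm rs by (simp add: star_mult mult.assoc) (metis mult.assoc)
  also have "\<dots> = I - e" by (simp add: rx mx star_diff es)
  finally have 1: "star x * x * (m * star m) = I - e" .
  have ab: "(star x * x + e) * (m * star m + e) = I"
  proof -
    have "e * (m * star m) = 0" "star x * x * e = 0"
      using em xe by (simp_all add: mult.assoc) (simp flip: mult.assoc)
    then show ?thesis by (simp add: distrib_left distrib_right 1 ee)
  qed
  have "(m * star m + e) * (star x * x + e) = star ((star x * x + e) * (m * star m + e))"
    by (simp add: star_simps es)
  then have "(m * star m + e) * (star x * x + e) = I" by (simp add: ab)
  then show ?thesis using ab by (auto simp: inverts_def ke)
qed

section \<open>The polar part\<close>

text \<open>Invertibility bounds h^2 below by \<delta>^2: the element \<open>H\<close>, formally h
  sqrt (1 - \<delta>^2 b^2), has square h^2 - \<delta>^2. Writing 1 - h^2 / 2 as (1 - \<delta>^2) /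
  2 + (1 - H^2) / 2 bounds its norm by 1 - \<delta>^2 / 2.\<close>

lemma norm_unit_diff_half_square_less_1:
  assumes h: "star h = h" "norm h < 1" and b: "inverts h b"
  shows "norm (I - (1/2::real) *\<^sub>R (h * h)) < 1"
proof -
  define \<delta> :: real where "\<delta> = 1 / (1 + norm b)"
  define a where "a = \<delta> *\<^sub>R b"
  have \<delta>: "0 < \<delta>" "\<delta> \<le> 1" by (simp_all add: \<delta>_def add_pos_nonneg)
  have bs: "star b = b" using cinv_eq[OF b] cinv_eq[OF inverts_star[OF b]] h by simp
  have a: "star a = a" "norm a < 1"
    by (simp_all add: a_def star_simps bs \<delta>_def add_pos_nonneg)
  note na = norm_hsqrt_square_less_1[OF a]
  define \<sigma> where "\<sigma> = hsqrt (a * a)"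
  have bh: "h * b = I" "b * h = I" using b by (auto simp: inverts_def)
  have "h * (a * a) = a * a * h"
    using bh by (simp add: a_def mult.assoc) (metis mult.assoc unit_left unit_right)
  then have h\<sigma>: "h * \<sigma> = \<sigma> * h" unfolding \<sigma>_def by (rule hsqrt_commute[OF na])
  have \<sigma>s: "star \<sigma> = \<sigma>" by (simp add: \<sigma>_def star_hsqrt[OF na] star_mult a)
  define H where "H = h - \<sigma> * h"
  have Hs: "star H = H" by (simp add: H_def star_simps \<sigma>s h h\<sigma>)
  have nH: "norm H < 1"
    using norm_diff_hsqrt_square_le[OF a, of h] h(2) by (simp add: H_def \<sigma>_def)
  have "H * H = h * h - (\<sigma> + \<sigma> - \<sigma> * \<sigma>) * (h * h)"
  proof -
    have "h * (\<sigma> * z) = \<sigma> * (h * z)" for z using h\<sigma> by (metis mult.assoc)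
    then show ?thesis by (simp add: H_def algebra_simps)
  qed
  also have "\<sigma> + \<sigma> - \<sigma> * \<sigma> = a * a" unfolding \<sigma>_def by (rule hsqrt_eq[OF na])
  also have "a * a * (h * h) = \<delta>\<^sup>2 *\<^sub>R I"
    using bh by (simp add: a_def power2_eq_square mult.assoc) (metis mult.assoc unit_left)
  finally have HH: "H * H = h * h - \<delta>\<^sup>2 *\<^sub>R I" .
  have "I - (1/2::real) *\<^sub>R (h * h) = ((1 - \<delta>\<^sup>2) / 2) *\<^sub>R I + (1/2::real) *\<^sub>R (I - H * H)"
  proof -
    have "I = (1/2) *\<^sub>R I + (1/2) *\<^sub>R I" by (simp flip: scaleR_add_left)
    moreover have "((1 - \<delta>\<^sup>2) / 2) *\<^sub>R I = (1/2) *\<^sub>R I - (1/2) *\<^sub>R (\<delta>\<^sup>2 *\<^sub>R I)"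
      by (simp add: scaleR_diff_left diff_divide_distrib)
    ultimately show ?thesis by (simp add: HH scaleR_diff_right scaleR_add_right algebra_simps)
  qed
  also have "norm \<dots> \<le> (1 - \<delta>\<^sup>2) / 2 * norm I + 1/2 * norm (I - H * H)"
    using \<delta> by (intro order_trans[OF norm_triangle_ineq]) (simp add: power_le_one)
  also have "\<dots> \<le> (1 - \<delta>\<^sup>2) / 2 * 1 + 1/2 * 1"
    using \<delta> norm_unit_le_1 norm_unit_diff_square_le_1[OF Hs nH]
    by (intro add_mono mult_left_mono) (auto simp: power_le_one)
  also have "\<dots> < 1" using \<delta> by (simp add: field_simps)
  finally show ?thesis .
qed

text \<open>A fourth root of \<open>T\<^sup>2\<close>, that is \<open>|T|\<^bsup>1/2\<^esup>\<close>; the constant \<open>18\<close> ensures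
  \<open>norm (1 - T\<^sup>2 / 18) < 1\<close> for invertible self-adjoint \<open>T\<close> of norm at most \<open>2\<close>.\<close>

definition abs_sqrt :: "'a \<Rightarrow> 'a" where
  "abs_sqrt T = sqrt (sqrt 18) *\<^sub>R (I - hsqrt (hsqrt (I - (1/18::real) *\<^sub>R (T * T))))"

lemma norm_abs_sqrt_arg:
  assumes "star T = T" "inverts T V" "norm T \<le> 2"
  shows "norm (I - (1/18::real) *\<^sub>R (T * T)) < 1"
proof -
  \<comment> \<open>The constant is 18 = 2 * 3^2, and \<open>T\<close> divided by 3 has norm below
    1.\<close>
  have "inverts ((1/3::real) *\<^sub>R T) (3 *\<^sub>R V)" using assms by (simp add: inverts_def)
  from norm_unit_diff_half_square_less_1[OF _ _ this] assms show ?thesis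
    by (simp add: star_simps)
qed

lemma abs_sqrt:
  assumes T: "star T = T" "inverts T V" "norm T \<le> 2"
  shows "star (abs_sqrt T) = abs_sqrt T"
    and "\<exists>b. inverts (abs_sqrt T) b"
    and "abs_sqrt T * abs_sqrt T * (abs_sqrt T * abs_sqrt T) = T * T"
    and "y * T = T * y \<Longrightarrow> y * abs_sqrt T = abs_sqrt T * y"
proof -
  define X where "X = I - (1/18::real) *\<^sub>R (T * T)"
  note n = norm_abs_sqrt_arg[OF T, folded X_def]
  note n' = norm_hsqrt_less_1[OF n]
  define \<sigma> where "\<sigma> = hsqrt (hsqrt X)"
  define c :: real where "c = sqrt (sqrt 18)"
  have c: "c > 0" "c * c * (c * c) = 18"
    by (simp_all add: c_def flip: power2_eq_square)
  have R: "abs_sqrt T = c *\<^sub>R (I - \<sigma>)" by (simp add: abs_sqrt_def c_def \<sigma>_def X_def)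
  have Xs: "star X = X" by (simp add: X_def star_simps T)
  show "star (abs_sqrt T) = abs_sqrt T"
    unfolding R by (simp add: star_simps \<sigma>_def star_hsqrt[OF n'] star_hsqrt[OF n] Xs)
  have "norm \<sigma> < 1" unfolding \<sigma>_def by (rule norm_hsqrt_less_1[OF n'])
  then have "norm (I - (1/c) *\<^sub>R abs_sqrt T) < 1" using c by (simp add: R)
  then show "\<exists>b. inverts (abs_sqrt T) b" using inverts_exists inverts_scaleR by blast
  have sq: "(I - s) * (I - s) = I - (s + s - s * s)" for s by (simp add: algebra_simps)
  have "(I - \<sigma>) * (I - \<sigma>) = I - hsqrt X" unfolding sq \<sigma>_def hsqrt_eq[OF n'] ..
  then have "(I - \<sigma>) * (I - \<sigma>) * ((I - \<sigma>) * (I - \<sigma>)) = I - X"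
    by (simp only: sq hsqrt_eq[OF n])
  then have "(c * c * (c * c)) *\<^sub>R ((I - \<sigma>) * (I - \<sigma>) * ((I - \<sigma>) * (I - \<sigma>))) = T * T"
    unfolding c by (simp add: X_def)
  then show "abs_sqrt T * abs_sqrt T * (abs_sqrt T * abs_sqrt T) = T * T"
    unfolding R by (simp add: mult.assoc)
  assume y: "y * T = T * y"
  have "y * (T * T) = T * T * y" using y by (metis mult.assoc)
  then have "y * X = X * y" by (simp add: X_def left_diff_distrib right_diff_distrib)
  then have "y * \<sigma> = \<sigma> * y" unfolding \<sigma>_def by (intro hsqrt_commute n n')
  then show "y * abs_sqrt T = abs_sqrt T * y"
    unfolding R by (simp add: left_diff_distrib right_diff_distrib)
qed

lemma hsqrt_scaleR_unit:
  assumes "0 \<le> t" "t < 1"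
  shows "hsqrt (t *\<^sub>R I) = (1 - sqrt (1 - t)) *\<^sub>R I"
proof (rule hsqrt_eqI)
  define s where "s = 1 - sqrt (1 - t)"
  have s: "0 \<le> s" "s < 1" using assms by (auto simp: s_def)
  have "norm (s *\<^sub>R I) \<le> s * 1" using s norm_unit_le_1 by (simp add: mult_left_le)
  then show "norm ((1 - sqrt (1 - t)) *\<^sub>R I) < 1" 
    unfolding s_def[symmetric] using s by linarith
  have "s + s - s * s = t" using assms by (simp add: s_def algebra_simps)
  then show "(1 - sqrt (1 - t)) *\<^sub>R I + (1 - sqrt (1 - t)) *\<^sub>R I
      - (1 - sqrt (1 - t)) *\<^sub>R I * ((1 - sqrt (1 - t)) *\<^sub>R I) = t *\<^sub>R I"
    unfolding s_def[symmetric] by (simp flip: scaleR_add_left scaleR_diff_left)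
qed

lemma abs_sqrt_unit: "abs_sqrt I = I"
proof -
  have "I - (1/18::real) *\<^sub>R (I * I) = (17/18) *\<^sub>R I"
    using scaleR_diff_left[of 1 "1/18" I] by simp
  moreover have "hsqrt ((17/18) *\<^sub>R I) = (1 - sqrt (1/18)) *\<^sub>R I"
    by (subst hsqrt_scaleR_unit) auto
  moreover have "hsqrt ((1 - sqrt (1/18)) *\<^sub>R I) = (1 - sqrt (sqrt (1/18))) *\<^sub>R I"
    by (subst hsqrt_scaleR_unit) auto
  ultimately have "abs_sqrt I = sqrt (sqrt 18) *\<^sub>R (I - (1 - sqrt (sqrt (1/18))) *\<^sub>R I)"
    unfolding abs_sqrt_def by (simp only:)
  also have "\<dots> = (sqrt (sqrt 18) * sqrt (sqrt (1/18))) *\<^sub>R I"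
    by (simp add: algebra_simps)
  also have "sqrt (sqrt 18) * sqrt (sqrt (1/18)) = 1" by (simp flip: real_sqrt_mult)
  finally show ?thesis by simp
qed

lemma continuous_on_abs_sqrt:
  assumes f: "continuous_on S f"
    and T: "\<And>s. s \<in> S \<Longrightarrow> star (f s) = f s \<and> (\<exists>V. inverts (f s) V) \<and> norm (f s) \<le> 2"
  shows "continuous_on S (\<lambda>s. abs_sqrt (f s))"
proof -
  have n: "norm (I - (1/18::real) *\<^sub>R (f s * f s)) < 1" if "s \<in> S" for s
    using T[OF that] norm_abs_sqrt_arg by blast
  have "continuous_on S (\<lambda>s. I - (1/18::real) *\<^sub>R (f s * f s))" by (intro continuous_intros f)
  then have "continuous_on S (\<lambda>s. hsqrt (I - (1/18::real) *\<^sub>R (f s * f s)))"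
    by (rule continuous_on_compose2[OF continuous_on_hsqrt]) (use n in auto)
  then have "continuous_on S (\<lambda>s. hsqrt (hsqrt (I - (1/18::real) *\<^sub>R (f s * f s))))"
    by (rule continuous_on_compose2[OF continuous_on_hsqrt]) (use norm_hsqrt_less_1[OF n] in auto)
  then show ?thesis unfolding abs_sqrt_def by (intro continuous_intros)
qed

definition polar_part :: "'a \<Rightarrow> 'a" where
  "polar_part x = x * cinv (abs_sqrt (star x * x + ker_proj x))"

lemma square_add_ker_proj:
  assumes x: "x * n * x = x" "norm x \<le> 1"
  shows "star (ker_proj x) = ker_proj x" "x * ker_proj x = 0"
    and "star (star x * x + ker_proj x) = star x * x + ker_proj x"
    and "norm (star x * x + ker_proj x) \<le> 2"
proof -
  define e where "e = ker_proj x"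
  have es: "star e = e" "x * e = 0" "e * e = e"
    using range_proj_ker[OF x(1)] range_proj by (auto simp: e_def)
  then show "star (ker_proj x) = ker_proj x" "x * ker_proj x = 0"
    "star (star x * x + ker_proj x) = star x * x + ker_proj x"
    by (simp_all add: e_def star_simps)
  have "norm (star x * x) \<le> 1" using x by (simp add: c_star_identity power_le_one)
  then show "norm (star x * x + ker_proj x) \<le> 2"
    using norm_triangle_ineq[of "star x * x" e] norm_idempotent_le_1[OF es(1,3)]
    by (simp add: e_def)
qed

text \<open>With \<open>h = star x * x\<close> and \<open>R = abs_sqrt T\<close>, everything
  commutes, k = h R^(-2) and h^2 = (1 - e) R^4, so k^2 = 1 - e. Since \<open>w * e = 0\<close>, this
  gives k^3 = k, and \<open>star_mult_self_idempotent\<close> applies.\<close>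

lemma polar_part:
  assumes x: "x * n * x = x" "norm x \<le> 1"
  shows "star (polar_part x) * polar_part x = I - ker_proj x"
    and "polar_part x * star (polar_part x) * polar_part x = polar_part x"
    and "polar_part x * star (polar_part x) * x = x"
proof -
  define e T where "e = ker_proj x" and "T = star x * x + e"
  have es: "star e = e" and xe: "x * e = 0" and Ts: "star T = T" and nT: "norm T \<le> 2"
    using square_add_ker_proj[OF x] by (auto simp: e_def T_def)
  have xee: "x * e = 0 \<Longrightarrow> e * e = e"
    using range_proj_ker[OF x(1)] by (simp add: e_def)
  then have ee: "e * e = e" using xe by blast
  obtain V where V: "inverts T V"
    using inverts_square_add_ker_proj[OF x(1)] by (auto simp: T_def e_def)
  define R B w where "R = abs_sqrt T" and "B = cinv R" and "w = polar_part x"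
  note R = abs_sqrt[OF Ts V nT, folded R_def]
  have RB: "inverts R B" using R(2) inverts_cinv by (auto simp: B_def)
  then have RB': "R * B = I" "B * R = I" by (auto simp: inverts_def)
  have Bs: "star B = B" using cinv_eq[OF RB] cinv_eq[OF inverts_star[OF RB]] R(1) by simp
  have w: "w = x * B" by (simp add: w_def polar_part_def B_def R_def T_def e_def)
  define h where "h = star x * x"
  have ex: "e * star x = 0" using star_mult[of x e] xe es by simp
  have he: "h * e = 0" "e * h = 0"
    using xe ex by (simp_all add: h_def mult.assoc) (simp flip: mult.assoc)
  have he': "e * (h * z) = 0" for z using he(2) by (metis mult.assoc mult_zero_left)
  have hT: "h * T = T * h" by (simp add: T_def distrib_left distrib_right he flip: h_def)
  have eT: "e * T = e" "T * e = e"
    by (simp_all add: T_def distrib_left distrib_right he ee flip: h_def)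
  have hB: "h * B = B * h" using inverts_commute[OF RB R(4)[OF hT]] .
  have eB: "e * B = B * e" using inverts_commute[OF RB R(4)] eT by simp
  define k where "k = star w * w"
  have k: "k = B * h * B" by (simp add: k_def w star_mult Bs h_def mult.assoc)
  have "k * k = I - e"
  proof -
    have "k = h * (B * B)" using hB by (metis k mult.assoc)
    then have "k * k = h * h * (B * B * (B * B))" using hB by (metis mult.assoc)
    moreover have "h * h = (I - e) * (R * R * (R * R))"
      unfolding R(3) by (simp add: T_def left_diff_distrib right_diff_distrib distrib_left distrib_right he he'
          ee flip: h_def)
    moreover have "(R * R * (R * R)) * (B * B * (B * B)) = I"
      by (metis RB'(1) mult.assoc unit_left)
    ultimately have "k * k = (I - e) * ((R * R * (R * R)) * (B * B * (B * B)))"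
      by (simp only: mult.assoc)
    also have "\<dots> = I - e" by (simp only: \<open>(R * R * (R * R)) * (B * B * (B * B)) = I\<close> unit_right)
    finally show ?thesis .
  qed
  have we: "w * e = 0" using eB xe by (metis w mult.assoc mult_zero_left)
  then have wk: "w * (k * k) = w" by (simp add: \<open>k * k = I - e\<close> right_diff_distrib)
  then have "k * k * k = k" by (simp add: k_def mult.assoc)
  then have "k * k = k" using star_mult_self_idempotent[of w] by (simp add: k_def)
  then show "star (polar_part x) * polar_part x = I - ker_proj x"
    using \<open>k * k = I - e\<close> by (simp add: k_def w_def e_def)
  have ww: "w * star w * w = w" using wk \<open>k * k = k\<close> by (simp add: k_def mult.assoc)
  then show "polar_part x * star (polar_part x) * polar_part x = polar_part x"
    by (simp add: w_def)
  have "x = w * R" using RB' by (simp add: w mult.assoc)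
  then show "polar_part x * star (polar_part x) * x = x"
    using ww by (metis w_def mult.assoc)
qed

section \<open>Elements at distance less than 1 from an extremal partial isometry\<close>

text \<open>The generalised inverse of \<open>x\<close> is \<open>a\<^sup>-\<^sup>1 u\<^sup>*\<close>, where \<open>a = 1 - u\<^sup>* (u - x)\<close> is
  invertible.\<close>

lemma
  assumes u: "kadison_condition u" and x: "norm (u - x) < 1"
  defines "a \<equiv> I - star u * (u - x)"
  shows near_extremal_inverts: "inverts a (cinv a)"
    and near_extremal_regular: "x * (cinv a * star u) * x = x"
    and near_extremal_ker: "I - cinv a * star u * x = cinv a * (I - star u * u)"
proof -
  have uu: "u * star u * u = u" and c: "\<And>z. (I - u * star u) * z * (I - star u * u) = 0"
    using u by (auto simp: kadison_condition_def left_diff_distrib right_diff_distrib algebra_simps)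
  have "norm u \<le> 1"
    using kadison_condition_imp_extremal[OF u] by (simp add: extremal_partial_isometry_iff)
  then have small: "norm (star u * (u - x)) < 1"
    using norm_mult_ineq[of "star u" "u - x"] mult_right_mono[of "norm u" 1 "norm (u - x)"] x
    by simp
  then show inv: "inverts a (cinv a)"
    using inverts_exists[of a] inverts_cinv by (auto simp: a_def)
  define b where "b = cinv a"
  have b: "a * b = I" "b * a = I" using inv by (auto simp: b_def inverts_def)
  define q where "q = star u * u"
  have ux: "star u * x = a - (I - q)" by (simp add: a_def q_def algebra_simps)
  have uq: "u * (I - q) = 0" using uu by (simp add: q_def right_diff_distrib mult.assoc)
  \<comment> \<open>Splits \<open>x * b * (I - q)\<close> by \<open>u * star u\<close>: this
    component vanishes because \<open>u * (I - q) = 0\<close>, the complementary one by Kadison's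
    condition.\<close>
  have "u * star u * (x * b * (I - q)) = u * ((star u * x) * b * (I - q))" by (simp add: mult.assoc)
  also have "\<dots> = u * (I - q) - u * (I - q) * b * (I - q)"
    by (simp add: ux left_diff_distrib right_diff_distrib b mult.assoc)
  finally have "u * star u * (x * b * (I - q)) = 0" by (simp add: uq)
  moreover have "x * b * (I - q) - u * star u * (x * b * (I - q)) = 0"
    using c[of "x * b"] by (simp add: q_def left_diff_distrib mult.assoc)
  ultimately have xb: "x * b * (I - q) = 0" by simp
  show k: "I - cinv a * star u * x = cinv a * (I - star u * u)"
    unfolding b_def[symmetric] q_def[symmetric] mult.assoc ux by (simp add: right_diff_distrib b)
  have "x - x * (b * star u) * x = x * (I - b * star u * x)"
    by (simp add: right_diff_distrib mult.assoc)
  also have "\<dots> = 0" using xb k by (simp add: b_def q_def mult.assoc)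
  finally show "x * (cinv a * star u) * x = x" by (simp add: b_def)
qed

text \<open>\<open>I - w * star w\<close> has \<open>I - u * star u\<close> as a factor and
  \<open>e\<close> has \<open>I - star u * u\<close> as a factor, so
  \<open>(I - w * star w) * z * e\<close> contains a product that Kadison's condition for
  \<open>u\<close> annihilates.\<close>

lemma polar_part_kadison_condition:
  assumes u: "kadison_condition u" and x: "norm (u - x) < 1" "norm x \<le> 1"
  shows "kadison_condition (polar_part x)"
proof -
  define a w e where "a = I - star u * (u - x)" and "w = polar_part x" and "e = ker_proj x"
  note inv = near_extremal_inverts[OF u x(1), folded a_def]
    and reg = near_extremal_regular[OF u x(1), folded a_def]
    and ker = near_extremal_ker[OF u x(1), folded a_def]
  note w = polar_part[OF reg x(2), folded w_def e_def]
  have c: "\<And>z. (I - u * star u) * z * (I - star u * u) = 0"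
    using u by (auto simp: kadison_condition_def left_diff_distrib right_diff_distrib algebra_simps)
  have "norm u \<le> 1"
    using kadison_condition_imp_extremal[OF u] by (simp add: extremal_partial_isometry_iff)
  then have "norm ((u - x) * star u) < 1"
    using norm_mult_ineq[of "u - x" "star u"] mult_left_mono[of "norm u" 1 "norm (u - x)"] x
    by simp
  then obtain b where b: "inverts (I - (u - x) * star u) b"
    using inverts_exists[of "I - (u - x) * star u"] by auto
  define d where "d = I - cinv a * star u * x"
  have "d * e = e"
    using range_proj_ker[OF reg] range_proj by (auto simp: d_def e_def mult.assoc)
  then have e: "e = cinv a * (I - star u * u) * e" using ker by (simp add: d_def)
  have left: "I - w * star w = (I - w * star w) * (I - u * star u) * b"
  proof -
    \<comment> \<open>Lets \<open>I - u * star u\<close> be replaced by the invertible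
      \<open>I - (u - x) * star u\<close>.\<close>
    have "(I - w * star w) * (x * star u) = 0"
      using w(3) by (simp add: left_diff_distrib flip: mult.assoc)
    then have "(I - w * star w) * (I - (u - x) * star u) = (I - w * star w) * (I - u * star u)"
      by (simp add: left_diff_distrib right_diff_distrib mult.assoc)
    moreover have "I - w * star w = (I - w * star w) * (I - (u - x) * star u) * b"
      using b by (simp add: inverts_def mult.assoc)
    ultimately show ?thesis by simp
  qed
  have "(I - w * star w) * z * e = 0" for z
  proof -
    have "(I - w * star w) * z * e =
        (I - w * star w) * (I - u * star u) * b * z * (cinv a * (I - star u * u) * e)"
      by (simp only: left[symmetric] e[symmetric])
    also have "\<dots> = (I - w * star w) *
        ((I - u * star u) * (b * z * cinv a) * (I - star u * u)) * e"
      by (simp only: mult.assoc)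
    finally show ?thesis by (simp add: c)
  qed
  moreover have "z - w * star w * z - z * (star w * w) + w * star w * z * (star w * w) =
      (I - w * star w) * z * e" for z
    unfolding w(1) by (simp add: algebra_simps)
  ultimately show ?thesis
    using w(2) unfolding kadison_condition_def w_def[symmetric] by simp
qed

lemma polar_part_self:
  assumes u: "kadison_condition u"
  shows "polar_part u = u"
proof -
  have uu: "u * star u * u = u" using u by (simp add: kadison_condition_def)
  have "ker_proj u = I - star u * u"
  proof (rule ker_proj_eqI)
    show "u * (I - star u * u) = 0" using uu by (simp add: right_diff_distrib mult.assoc)
  qed (simp_all add: star_simps left_diff_distrib mult.assoc)
  then have "star u * u + ker_proj u = I" by simp
  then show ?thesis
    using cinv_eq[of I I] by (simp add: polar_part_def abs_sqrt_unit inverts_def)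
qed

text \<open>The fixed \<open>u\<close> supplies an explicit generalised inverse that varies
  continuously with \<open>f s\<close>; this carries continuity to the kernel projection, then to
  \<open>T\<close>, its root and the inverse of that root.\<close>

lemma continuous_on_polar_part:
  assumes u: "kadison_condition u" and f: "continuous_on S f"
    and x: "\<And>s. s \<in> S \<Longrightarrow> norm (u - f s) < 1 \<and> norm (f s) \<le> 1"
  shows "continuous_on S (\<lambda>s. polar_part (f s))"
proof -
  define a d where "a s = I - star u * (u - f s)" and "d s = I - cinv (a s) * star u * f s" for s
  have inv: "inverts (a s) (cinv (a s))" and reg: "f s * (cinv (a s) * star u) * f s = f s"
    if "s \<in> S" for s
    using near_extremal_inverts[OF u] near_extremal_regular[OF u] x[OF that]
    by (auto simp: a_def)
  have "continuous_on S a" unfolding a_def by (intro continuous_intros f)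
  then have "continuous_on S (\<lambda>s. cinv (a s))" by (rule continuous_on_cinv) (use inv in blast)
  then have d: "continuous_on S d" unfolding d_def by (intro continuous_intros f)
  have dd: "d s * d s = d s" and ker: "ker_proj (f s) = range_proj (d s)" if "s \<in> S" for s
    using range_proj_ker[OF reg[OF that]] by (auto simp: d_def)
  have "continuous_on S (\<lambda>s. cinv (d s + star (d s) - I))"
    by (intro continuous_on_cinv continuous_intros d) (use dd inverts_idempotent_exists in blast)
  then have "continuous_on S (\<lambda>s. range_proj (d s))"
    unfolding range_proj_def by (intro continuous_intros d)
  then have e: "continuous_on S (\<lambda>s. ker_proj (f s))"
    by (rule continuous_on_eq) (simp add: ker)
  define T where "T s = star (f s) * f s + ker_proj (f s)" for s
  have T: "star (T s) = T s" "\<exists>V. inverts (T s) V" "norm (T s) \<le> 2" if "s \<in> S" for s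
    using square_add_ker_proj[OF reg[OF that]] inverts_square_add_ker_proj[OF reg[OF that]] x[OF that]
    by (auto simp: T_def)
  have "continuous_on S T" unfolding T_def by (intro continuous_intros f e)
  then have "continuous_on S (\<lambda>s. abs_sqrt (T s))"
    by (rule continuous_on_abs_sqrt) (use T in blast)
  then have "continuous_on S (\<lambda>s. cinv (abs_sqrt (T s)))"
    by (rule continuous_on_cinv) (use T abs_sqrt(2) in blast)
  then show ?thesis unfolding polar_part_def T_def by (intro continuous_intros f)
qed

end

section \<open>The path from \<open>u\<close> to \<open>v\<close>\<close>

theorem theorem5:
  fixes u v :: "'a::c_star_algebra"
  assumes "extremal_partial_isometry u"
    and "extremal_partial_isometry v"
    and "norm (u - v) < 2"
  shows "\<exists>w :: real \<Rightarrow> 'a. continuous_on {0..1} w \<and>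
           (\<forall>t\<in>{0..1}. extremal_partial_isometry (w t)) \<and> w 0 = u \<and> w 1 = v"
proof -
  have u: "kadison_condition u" and v: "kadison_condition v"
    using assms by (auto intro: extremal_imp_kadison_condition)
  have nuv: "norm u \<le> 1" "norm v \<le> 1"
    using assms by (auto simp: extremal_partial_isometry_iff)
  obtain I :: 'a where "\<forall>x. I * x = x \<and> x * I = x" using kadison_condition_imp_unit[OF u] by blast
  then interpret c_star_unit I by unfold_locales auto
  define x where "x t = (1 - t) *\<^sub>R u + t *\<^sub>R v" for t :: real
  have cx: "continuous_on S x" for S unfolding x_def by (intro continuous_intros)
  have nx: "norm (x t) \<le> 1" if "t \<in> {0..1}" for t
    using convexD_alt[OF convex_cball[of 0 1], of u v t] nuv that by (simp add: x_def)
  have near_u: "norm (u - x t) < 1" if "t \<in> {0..1/2}" for t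
  proof -
    have "u - x t = t *\<^sub>R (u - v)" by (simp add: x_def algebra_simps)
    then have "norm (u - x t) = t * norm (u - v)" using that by simp
    also have "\<dots> \<le> 1/2 * norm (u - v)" using that by (intro mult_right_mono) auto
    finally show ?thesis using assms(3) by linarith
  qed
  have near_v: "norm (v - x t) < 1" if "t \<in> {1/2..1}" for t
  proof -
    have "v - x t = (1 - t) *\<^sub>R (v - u)" by (simp add: x_def algebra_simps)
    then have "norm (v - x t) = (1 - t) * norm (v - u)" using that by simp
    also have "\<dots> \<le> 1/2 * norm (v - u)" using that by (intro mult_right_mono) auto
    finally show ?thesis using assms(3) by (simp add: norm_minus_commute)
  qed
  have split: "{0..1} = {0..1/2} \<union> {1/2..1::real}" by auto
  \<comment> \<open>Continuity is proved near \<open>u\<close> on the first half and near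
    \<open>v\<close> on the second; both halves carry the same function, so the values at 1/2
    agree.\<close>
  have "continuous_on {0..1} (\<lambda>t. polar_part (x t))"
    unfolding split
    by (intro continuous_on_closed_Un closed_atLeastAtMost
        continuous_on_polar_part[OF u cx] continuous_on_polar_part[OF v cx])
      (use near_u near_v nx in auto)
  moreover have "extremal_partial_isometry (polar_part (x t))" if "t \<in> {0..1}" for t
    using that near_u near_v nx polar_part_kadison_condition[OF u] polar_part_kadison_condition[OF v]
      kadison_condition_imp_extremal split by blast
  moreover have "polar_part (x 0) = u" "polar_part (x 1) = v"
    by (simp_all add: x_def polar_part_self u v)
  ultimately show ?thesis by blast
qed

end
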